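(* Let $f:\mathbb{R}^n\to(-\infty,\infty]$ be proper, lower semicontinuous and prox-bounded with threshold $\lambda_f>0$, and let $g:\mathbb{R}^n\to\mathbb{R}$ be differentiable with Lipschitz continuous gradient with constant $L>0$. Assume $\inf(f+g)>-\infty$ and $0<\lambda<\min\{\frac{1}{4L},\lambda_f\}$. Let $(x_k)_{k\geq -1}$ be a sequence generated by the FRB method with step-size $\lambda$, put $z_k=(x_{k+1},x_k)$ for $k\ge -1$, and assume that $(z_k)_{k\ge -1}$ is bounded. Suppose that the FRB merit function $H$ has the generalized concave Kurdyka-Łojasiewicz property on the set $\omega(z_{-1})$ of limit points of $(z_k)_{k\ge-1}$, and let $x^*$ be the limit of $(x_k)$ (which exists under these assumptions). Suppose that $H$ has KL exponent $\theta\in[0,1)$ at $(x^*,x^* )$. Then: (i) If $\theta=0$, then $(x_k)_{k\ge-1}$ converges to $x^*$ in finitely many steps. (ii) If $\theta\in(0,\frac12]$, then there exist $Q_1\in(0,1)$ and $c_1>0$ such that $\|x_k-x^*\|\le Q_1^k c_1$ for all $k$ sufficiently large. (iii) If $\theta\in(\frac12,1)$, then there exists $Q_2>0$ such that $\|x_k-x^*\|\le Q_2\, k^{-\frac{1-\theta}{2\theta-1}}$ for all $k$ sufficiently large.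
   Context: Norms are Euclidean, and $\|(x,y)\|=\sqrt{\|x\|^2+\|y\|^2}$ on $\mathbb{R}^n\times\mathbb{R}^n$. A proper lsc $f$ is prox-bounded if $f+\frac{1}{2\lambda}\|\cdot\|^2$ is bounded below for some $\lambda>0$; the supremum $\lambda_f\in(0,\infty]$ of all such $\lambda$ is its threshold. $\mathrm{Prox}_{\lambda f}(x)=\operatorname{argmin}_{y}\{f(y)+\frac{1}{2\lambda}\|x-y\|^2\}$ (a set). FRB method: given arbitrary $x_{-1},x_0\in\mathbb{R}^n$ and $\lambda>0$, for $k=0,1,2,\dots$ let $y_k=x_k+\lambda(\nabla g(x_{k-1})-\nabla g(x_k))$ and choose $x_{k+1}\in\mathrm{Prox}_{\lambda f}(y_k-\lambda\nabla g(x_k))$. FRB merit function: $H(x,y)=f(x)+g(x)+\frac{1}{4\lambda}\|x-y\|^2$ on $\mathbb{R}^n\times\mathbb{R}^n$. Subdifferentials: for a proper function $h$ and $\bar x\in\operatorname{dom}h$, $v\in\hat\partial h(\bar x)$ (Fréchet) if $h(x)\ge h(\bar x)+\langle v,x-\bar x\rangle+o(\|x-\bar x\|)$; $v\in\partial h(\bar x)$ (limiting) if there are $x_k\to\bar x$ with $h(x_k)\to h(\bar x)$ and $v_k\in\hat\partial h(x_k)$ with $v_k\to v$. $\partial h(x)=\emptyset$ for $x\notin\operatorname{dom}h$; $\operatorname{dom}\partial h=\{x:\partial h(x)\ne\emptyset\}$; $\operatorname{dist}(x,\emptyset)=\infty$. $[a<h<b]=\{x:a<h(x)<b\}$. For $\eta\in(0,\infty]$,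 $\Phi_\eta$ is the class of functions $\varphi:[0,\eta)\to[0,\infty)$ that are right-continuous at $0$ with $\varphi(0)=0$ and strictly increasing on $[0,\eta)$. Let $h$ be proper lsc and $V\subseteq\operatorname{dom}\partial h$ nonempty with $h=\mu$ on $V$. Then $h$ has the generalized concave Kurdyka-Łojasiewicz (KL) property on $V$ if there exist an open set $U\supseteq V$, $\eta\in(0,\infty]$ and a concave $\varphi\in\Phi_\eta$ such that for every $x\in U\cap[0<h-\mu<\eta]$, $\varphi'_-(h(x)-\mu)\cdot\operatorname{dist}(0,\partial h(x))\ge1$, where $\varphi'_-$ is the left derivative. (In the situation of the theorem, $\omega(z_{-1})$ is nonempty and compact, is contained in $\operatorname{dom}\partial H$, and $H$ is constant on it.) $h$ has KL exponent $\theta\in[0,1)$ at $\bar x\in\operatorname{dom}\partial h$ if there are $c>0$, $\eta\in(0,\infty]$ and a neighborhood $U$ of $\bar x$ such that the inequality holds with $\varphi(t)=c\,t^{1-\theta}$ and $\mu=h(\bar x)$, i.e. $c(1-\theta)(h(x)-h(\bar x))^{-\theta}\operatorname{dist}(0,\partial h(x))\ge 1$ for all $x\in U\cap[0<h-h(\bar x)<\eta]$. *)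

theory Defs
  imports "HOL-Analysis.Analysis" "HOL-Library.Landau_Symbols"
begin

definition proper_fun :: "('a \<Rightarrow> ereal) \<Rightarrow> bool" where
  "proper_fun h \<longleftrightarrow> (\<forall>x. h x \<noteq> -\<infinity>) \<and> (\<exists>x. h x \<noteq> \<infinity>)"

definition edom :: "('a \<Rightarrow> ereal) \<Rightarrow> 'a set" where
  "edom h = {x. h x < \<infinity>}"

definition lsc :: "('a::topological_space \<Rightarrow> ereal) \<Rightarrow> bool" where
  "lsc h \<longleftrightarrow> (\<forall>x. h x \<le> Liminf (at x) h)"

text \<open>\<open>infdist\<close> is \<open>0\<close> on the empty set; here the distance to the empty set is \<open>\<infinity>\<close>.\<close>

definition edist_set :: "'a::metric_space \<Rightarrow> 'a set \<Rightarrow> ereal" where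
  "edist_set x S = (INF v\<in>S. ereal (dist x v))"

definition prox_param :: "('a::real_normed_vector \<Rightarrow> ereal) \<Rightarrow> real \<Rightarrow> bool" where
  "prox_param f lam \<longleftrightarrow>
     lam > 0 \<and> (\<exists>m::real. \<forall>y. ereal m \<le> f y + ereal (1 / (2 * lam) * (norm y)\<^sup>2))"

definition prox_bounded :: "('a::real_normed_vector \<Rightarrow> ereal) \<Rightarrow> bool" where
  "prox_bounded f \<longleftrightarrow> (\<exists>lam. prox_param f lam)"

definition prox_threshold :: "('a::real_normed_vector \<Rightarrow> ereal) \<Rightarrow> ereal" where
  "prox_threshold f = Sup (ereal ` {lam. prox_param f lam})"

definition Prox :: "real \<Rightarrow> ('a::real_normed_vector \<Rightarrow> ereal) \<Rightarrow> 'a \<Rightarrow> 'a set" where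
  "Prox lam f x =
     {y. is_arg_min (\<lambda>u. f u + ereal (1 / (2 * lam) * (norm (x - u))\<^sup>2)) (\<lambda>_. True) y}"

definition frechet_subdiff :: "('a::real_inner \<Rightarrow> ereal) \<Rightarrow> 'a \<Rightarrow> 'a set" where
  "frechet_subdiff h xb =
     {v. xb \<in> edom h \<and>
         (\<exists>r. r \<in> o[at xb](\<lambda>x. norm (x - xb)) \<and>
              (\<forall>\<^sub>F x in at xb. h xb + ereal (v \<bullet> (x - xb) + r x) \<le> h x))}"

definition limiting_subdiff :: "('a::real_inner \<Rightarrow> ereal) \<Rightarrow> 'a \<Rightarrow> 'a set" where
  "limiting_subdiff h xb =
     {v. xb \<in> edom h \<and>
         (\<exists>u w. u \<longlonglongrightarrow> xb \<and> (\<lambda>k. h (u k)) \<longlonglongrightarrow> h xb \<and>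
                (\<forall>k::nat. w k \<in> frechet_subdiff h (u k)) \<and> w \<longlonglongrightarrow> v)}"

definition dom_subdiff :: "('a::real_inner \<Rightarrow> ereal) \<Rightarrow> 'a set" where
  "dom_subdiff h = {x. limiting_subdiff h x \<noteq> {}}"

definition left_deriv :: "(real \<Rightarrow> real) \<Rightarrow> real \<Rightarrow> real" where
  "left_deriv \<phi> t = (THE D. (\<phi> has_real_derivative D) (at_left t))"

definition Ico0 :: "ereal \<Rightarrow> real set" where
  "Ico0 \<eta> = {t. 0 \<le> t \<and> ereal t < \<eta>}"

text \<open>The values of \<open>\<phi>\<close> outside \<open>[0, \<eta>)\<close> are irrelevant.\<close>

definition Phi_class :: "ereal \<Rightarrow> (real \<Rightarrow> real) set" where
  "Phi_class \<eta> =
     {\<phi>. (\<forall>t\<in>Ico0 \<eta>. 0 \<le> \<phi> t) \<and> continuous (at_right 0) \<phi> \<and> \<phi> 0 = 0 \<and>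
         strict_mono_on (Ico0 \<eta>) \<phi>}"

definition KL_ineq ::
    "('a::real_inner \<Rightarrow> ereal) \<Rightarrow> real \<Rightarrow> 'a set \<Rightarrow> ereal \<Rightarrow> (real \<Rightarrow> real) \<Rightarrow> bool" where
  "KL_ineq h \<mu> U \<eta> \<phi> \<longleftrightarrow>
     (\<forall>x \<in> U \<inter> {x. 0 < h x - ereal \<mu> \<and> h x - ereal \<mu> < \<eta>}.
        1 \<le> ereal (left_deriv \<phi> (real_of_ereal (h x - ereal \<mu>)))
              * edist_set 0 (limiting_subdiff h x))"

definition gen_concave_KL_on :: "('a::real_inner \<Rightarrow> ereal) \<Rightarrow> 'a set \<Rightarrow> bool" where
  "gen_concave_KL_on h V \<longleftrightarrow>
     V \<noteq> {} \<and> V \<subseteq> dom_subdiff h \<and>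
     (\<exists>\<mu>::real. (\<forall>x\<in>V. h x = ereal \<mu>) \<and>
        (\<exists>U \<eta> \<phi>. open U \<and> V \<subseteq> U \<and> 0 < \<eta> \<and> \<phi> \<in> Phi_class \<eta> \<and>
                  concave_on (Ico0 \<eta>) \<phi> \<and> KL_ineq h \<mu> U \<eta> \<phi>))"

definition has_KL_exponent :: "('a::real_inner \<Rightarrow> ereal) \<Rightarrow> 'a \<Rightarrow> real \<Rightarrow> bool" where
  "has_KL_exponent h xb \<theta> \<longleftrightarrow>
     xb \<in> dom_subdiff h \<and>
     (\<exists>c \<eta> U. 0 < c \<and> 0 < \<eta> \<and> open U \<and> xb \<in> U \<and>
        KL_ineq h (real_of_ereal (h xb)) U \<eta> (\<lambda>t. c * t powr (1 - \<theta>)))"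

lemma left_deriv_powr:
  assumes "0 < t"
  shows "left_deriv (\<lambda>t. c * t powr (1 - \<theta>)) t = c * (1 - \<theta>) * t powr (- \<theta>)"
proof -
  have *: "((\<lambda>t. c * t powr (1 - \<theta>)) has_real_derivative c * (1 - \<theta>) * t powr (- \<theta>)) (at_left t)"
    using assms by (auto intro!: derivative_eq_intros)
  show ?thesis
    unfolding left_deriv_def
  proof (rule the_equality)
    fix D assume "((\<lambda>t. c * t powr (1 - \<theta>)) has_real_derivative D) (at_left t)"
    with * show "D = c * (1 - \<theta>) * t powr (- \<theta>)"
      unfolding has_field_derivative_iff
      using tendsto_unique[OF trivial_limit_at_left_real] by blast
  qed (fact *)
qed

text \<open>\<open>G\<close> stands for the gradient of \<open>g\<close>. The iterates are indexed by \<open>k \<ge> -1\<close>; the values of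
  \<open>x\<close> at smaller indices are irrelevant.\<close>

definition FRB_sequence ::
    "real \<Rightarrow> ('a::real_normed_vector \<Rightarrow> ereal) \<Rightarrow> ('a \<Rightarrow> 'a) \<Rightarrow> (int \<Rightarrow> 'a) \<Rightarrow> bool" where
  "FRB_sequence lam f G x \<longleftrightarrow>
     (\<forall>k\<ge>0. let y = x k + lam *\<^sub>R (G (x (k - 1)) - G (x k))
             in x (k + 1) \<in> Prox lam f (y - lam *\<^sub>R G (x k)))"

definition FRB_merit ::
    "real \<Rightarrow> ('a::real_normed_vector \<Rightarrow> ereal) \<Rightarrow> ('a \<Rightarrow> real) \<Rightarrow> 'a \<times> 'a \<Rightarrow> ereal" where
  "FRB_merit lam f g =
     (\<lambda>(x, y). f x + ereal (g x) + ereal (1 / (4 * lam) * (norm (x - y))\<^sup>2))"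


definition seq_limit_points :: "(int \<Rightarrow> 'a::topological_space) \<Rightarrow> 'a set" where
  "seq_limit_points z =
     {p. \<exists>r::nat \<Rightarrow> int. strict_mono r \<and> (\<forall>j. -1 \<le> r j) \<and> (\<lambda>j. z (r j)) \<longlonglongrightarrow> p}"

end

theory Submission
  imports Defs
begin

text \<open>Comparing the prox step with the previous iterate and using the descent lemma for \<open>g\<close> shows
  that the merit value \<open>h n\<close> at \<open>(x (n+1), x n)\<close> drops by at least
  \<open>M1 * ((d n)\<^sup>2 + (d (n+1))\<^sup>2)\<close>, where \<open>d n = norm (x (n+1) - x n)\<close>, while Fermat's rule gives a
  subgradient there of norm at most \<open>M2 * (d (n-1) + d n)\<close>. Concavity of the desingularising function
  \<open>\<phi>\<close> turns the KL inequality into a telescoping bound, so the path has finite length and the distance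
  to the limit is at most a multiple of \<open>\<phi> (h (n+1))\<close> plus \<open>d n / 2\<close>. For the rates, the exponent
  inequality is squared instead: \<open>h (n+1) powr (2 * \<theta>) \<le> C * (h n - h (n+1))\<close>. This scalar recursion
  gives geometric decay of \<open>h\<close> for \<open>\<theta> \<le> 1/2\<close> and decay of order \<open>n powr (- (1 / (2 * \<theta> - 1)))\<close>
  for \<open>\<theta> > 1/2\<close>, and the distance bound with \<open>\<phi> t = c * t powr (1 - \<theta>)\<close> transfers both to the
  iterates.\<close>

subsection \<open>Desingularising functions and subgradients\<close>

text \<open>By concavity the chord slopes \<open>q\<close> towards \<open>t\<close> decrease as
  their base point rises to \<open>t\<close>, and monotonicity of \<phi> keeps them nonnegative, so
  they converge to their infimum \<open>D\<close>. This makes the definite description in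
  \<open>left_deriv\<close> denote, and \<open>D\<close> being at most every slope is the tangent
  inequality.\<close>

lemma left_deriv_concave_tangent:
  assumes conc: "concave_on (Ico0 \<eta>) \<phi>" and mono: "mono_on (Ico0 \<eta>) \<phi>"
    and t: "0 < t" "ereal t < \<eta>" and s: "0 \<le> s" "s \<le> t"
  shows "left_deriv \<phi> t * (t - s) \<le> \<phi> t - \<phi> s"
proof -
  define q where "q s = (\<phi> s - \<phi> t) / (s - t)" for s
  have I: "s \<in> Ico0 \<eta>" if "0 \<le> s" "s \<le> t" for s
    using that t(2) by (auto simp: Ico0_def intro: le_less_trans[of _ "ereal t"])
  have q_mono: "q b \<le> q a" if "0 \<le> a" "a \<le> b" "b < t" for a b
  proof (cases "a = b")
    case False
    have "((\<lambda>x. - \<phi> x) a - (\<lambda>x. - \<phi> x) t) / (a - t) \<le> ((\<lambda>x. - \<phi> x) b - (\<lambda>x. - \<phi> x) t) / (b - t)"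
      by (rule convex_on_slope_le(2)[where I="Ico0 \<eta>"]) (use conc that False I in \<open>auto simp: concave_on_def\<close>)
    then show ?thesis
      by (simp add: q_def diff_divide_distrib)
  qed simp
  have q_nonneg: "0 \<le> q a" if "0 \<le> a" "a < t" for a
    unfolding q_def using mono_onD[OF mono I I, of a t] that by (intro divide_nonpos_neg) auto
  define D where "D = Inf (q ` {0..<t})"
  have bdd: "bdd_below (q ` {0..<t})"
    using q_nonneg by (intro bdd_belowI2[of _ 0]) auto
  have D_le: "D \<le> q a" if "0 \<le> a" "a < t" for a
    unfolding D_def using that by (intro cInf_lower bdd) auto
  have "(q \<longlongrightarrow> D) (at_left t)"
  proof (rule order_tendstoI)
    fix a assume "a < D"
    then show "\<forall>\<^sub>F x in at_left t. a < q x"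
      using t(1) D_le unfolding eventually_at_left_field
      by (intro exI[of _ 0]) (meson less_eq_real_def less_le_trans)
  next
    fix a assume "D < a"
    then obtain b where "0 \<le> b" "b < t" "q b < a"
      unfolding D_def using cInf_less_iff[OF _ bdd, of a] t(1) by auto
    then show "\<forall>\<^sub>F x in at_left t. q x < a"
      unfolding eventually_at_left_field
      by (intro exI[of _ b]) (meson q_mono less_eq_real_def le_less_trans)
  qed
  then have lim: "((\<lambda>s. (\<phi> s - \<phi> t) / (s - t)) \<longlongrightarrow> D) (at_left t)"
    by (simp add: q_def[abs_def])
  have "left_deriv \<phi> t = D"
    unfolding left_deriv_def has_field_derivative_iff
    using tendsto_unique[OF trivial_limit_at_left_real _ lim] lim by blast
  then show ?thesis
    using D_le[of s] s by (cases "s = t") (auto simp: q_def field_simps)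
qed

text \<open>Weighted AM-GM for \<open>s\<close> and \<open>t\<close>, multiplied by
  \<open>t powr (- \<theta>)\<close>. It supplies for the KL exponent what concavity supplies for a
  general \<phi>.\<close>

lemma left_deriv_powr_tangent:
  fixes c \<theta> t s :: real
  assumes "0 < c" "0 \<le> \<theta>" "\<theta> < 1" "0 < t" "0 \<le> s"
  shows "left_deriv (\<lambda>t. c * t powr (1 - \<theta>)) t * (t - s) \<le> c * t powr (1 - \<theta>) - c * s powr (1 - \<theta>)"
proof -
  have "s powr (1 - \<theta>) * t powr \<theta> \<le> (1 - \<theta>) * s + \<theta> * t"
    using Youngs_inequality_0[of "1 - \<theta>" \<theta> s t] assms by (cases "s = 0") auto
  then have "s powr (1 - \<theta>) * t powr \<theta> * t powr (- \<theta>) \<le> ((1 - \<theta>) * s + \<theta> * t) * t powr (- \<theta>)"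
    by (rule mult_right_mono) simp
  then have "s powr (1 - \<theta>) \<le> (1 - \<theta>) * t powr (- \<theta>) * s + \<theta> * (t * t powr (- \<theta>))"
    using assms by (simp add: mult.assoc powr_add[symmetric]) (simp add: algebra_simps)
  moreover have "t * t powr (- \<theta>) = t powr (1 - \<theta>)"
    using assms powr_add[of t 1 "- \<theta>"] by simp
  ultimately have "(1 - \<theta>) * t powr (- \<theta>) * (t - s) \<le> t powr (1 - \<theta>) - s powr (1 - \<theta>)"
    by (simp add: algebra_simps)
  then have "c * ((1 - \<theta>) * t powr (- \<theta>) * (t - s)) \<le> c * (t powr (1 - \<theta>) - s powr (1 - \<theta>))"
    by (rule mult_left_mono) (use assms in simp)
  then show ?thesis
    using assms by (simp add: left_deriv_powr algebra_simps)
qed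

lemma frechet_subset_limiting_subdiff: "frechet_subdiff h p \<subseteq> limiting_subdiff h p"
proof
  fix v assume v: "v \<in> frechet_subdiff h p"
  then have "p \<in> edom h"
    by (simp add: frechet_subdiff_def)
  with v show "v \<in> limiting_subdiff h p"
    unfolding limiting_subdiff_def
    by (intro CollectI conjI exI[of _ "\<lambda>_. p"] exI[of _ "\<lambda>_. v"]) auto
qed

text \<open>The linearisation error of \<open>S\<close> serves as the little-o remainder of
  \<open>h\<close>. This plays the part of Fermat's rule combined with a sum rule for a smooth
  perturbation.\<close>

lemma frechet_subdiff_smooth_minorant:
  fixes S :: "'a::real_inner \<Rightarrow> real"
  assumes S: "(S has_derivative (\<lambda>d. v \<bullet> d)) (at p)"
    and eq: "h p = ereal (S p)" and le: "\<And>x. ereal (S x) \<le> h x"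
  shows "v \<in> frechet_subdiff h p"
proof -
  define r where "r x = S x - S p - v \<bullet> (x - p)" for x
  have "((\<lambda>x. norm (r x) / norm (x - p)) \<longlongrightarrow> 0) (at p)"
    using S by (simp add: has_derivative_iff_norm r_def)
  then have "((\<lambda>x. r x / norm (x - p)) \<longlongrightarrow> 0) (at p)"
    by (subst tendsto_norm_zero_iff[symmetric]) simp
  then have "r \<in> o[at p](\<lambda>x. norm (x - p))"
    by (intro smalloI_tendsto) (auto simp: eventually_at_filter)
  moreover have "h p + ereal (v \<bullet> (x - p) + r x) \<le> h x" for x
    using le[of x] by (simp add: eq r_def)
  ultimately show ?thesis
    using eq by (auto simp: frechet_subdiff_def edom_def)
qed

text \<open>On the segment from \<open>x\<close> to \<open>y\<close>, subtracting the linear and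
  quadratic terms from \<open>g\<close> leaves a function \<open>q\<close> whose derivative is
  nonpositive by Cauchy-Schwarz and the Lipschitz bound; compare its values at 0 and 1.\<close>

lemma lipschitz_gradient_descent:
  fixes g :: "'a::real_inner \<Rightarrow> real"
  assumes G: "\<And>u. GDERIV g u :> G u" and L: "L-lipschitz_on UNIV G"
  shows "g y \<le> g x + G x \<bullet> (y - x) + L / 2 * (norm (y - x))\<^sup>2"
proof -
  define d where "d = y - x"
  define q where "q t = g (x + t *\<^sub>R d) - t * (G x \<bullet> d) - L / 2 * t\<^sup>2 * (norm d)\<^sup>2" for t
  have "q 1 \<le> q 0"
  proof (rule DERIV_nonpos_imp_nonincreasing[where f = q])
    fix t :: real assume t: "0 \<le> t" "t \<le> 1"
    have "((\<lambda>t. g (x + t *\<^sub>R d)) has_derivative (\<lambda>h. (h *\<^sub>R d) \<bullet> G (x + t *\<^sub>R d))) (at t)"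
      by (rule has_derivative_compose[where f="\<lambda>t. x + t *\<^sub>R d" and f'="\<lambda>h. h *\<^sub>R d" and g=g,
            OF _ G[unfolded gderiv_def]])
        (auto intro!: derivative_eq_intros)
    then have "((\<lambda>t. g (x + t *\<^sub>R d)) has_real_derivative (d \<bullet> G (x + t *\<^sub>R d))) (at t)"
      unfolding has_field_derivative_def by (simp add: mult_commute_abs)
    then have "(q has_real_derivative (d \<bullet> G (x + t *\<^sub>R d) - G x \<bullet> d - L * t * (norm d)\<^sup>2)) (at t)"
      unfolding q_def by (auto intro!: derivative_eq_intros)
    moreover have "d \<bullet> G (x + t *\<^sub>R d) - G x \<bullet> d - L * t * (norm d)\<^sup>2 \<le> 0"
    proof -
      have "d \<bullet> G (x + t *\<^sub>R d) - G x \<bullet> d = d \<bullet> (G (x + t *\<^sub>R d) - G x)"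
        by (simp add: inner_diff_right inner_commute)
      also have "\<dots> \<le> norm d * norm (G (x + t *\<^sub>R d) - G x)"
        by (rule norm_cauchy_schwarz)
      also have "\<dots> \<le> norm d * (L * (t * norm d))"
        using lipschitz_onD[OF L, of "x + t *\<^sub>R d" x] t
        by (intro mult_left_mono) (auto simp: dist_norm)
      finally show ?thesis
        by (simp add: power2_eq_square algebra_simps)
    qed
    ultimately show "\<exists>y. DERIV q t :> y \<and> y \<le> 0" by blast
  qed simp
  then show ?thesis
    by (simp add: q_def d_def)
qed

subsection \<open>Scalar recursions\<close>

text \<open>AM-GM applied to \<open>u\<close> and \<open>(a + b) / 4\<close>. The weight 1/4 is
  chosen so that doubling the resulting bound leaves \<open>(a - b) / 2\<close>, which telescopes
  when the steps are summed.\<close>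

lemma finite_length_step:
  fixes a b u :: real
  assumes "b\<^sup>2 \<le> u * (a + b)" "0 \<le> a" "0 \<le> b" "0 \<le> u"
  shows "b \<le> 2 * u + (a - b) / 2"
proof -
  have "4 * (u * ((a + b) / 4)) \<le> (u + (a + b) / 4)\<^sup>2"
    using zero_le_power2[of "u - (a + b) / 4"] by (simp add: power2_eq_square field_simps)
  then have "b\<^sup>2 \<le> (u + (a + b) / 4)\<^sup>2"
    using assms(1) by simp
  then have "b \<le> u + (a + b) / 4"
    by (rule power2_le_imp_le) (use assms in simp)
  then show ?thesis
    by (simp add: field_simps)
qed

lemma finite_length_sum:
  fixes d \<psi> :: "nat \<Rightarrow> real"
  assumes step: "\<And>n. N \<le> n \<Longrightarrow> (d (Suc n))\<^sup>2 \<le> C * (\<psi> n - \<psi> (Suc n)) * (d n + d (Suc n))"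
    and d: "\<And>n. 0 \<le> d n" and dec: "\<And>n. N \<le> n \<Longrightarrow> \<psi> (Suc n) \<le> \<psi> n" and C: "0 \<le> C"
    and n: "N \<le> n"
  shows "(\<Sum>i<m. d (Suc n + i)) \<le> 2 * C * (\<psi> n - \<psi> (n + m)) + (d n - d (n + m)) / 2"
proof (induction m)
  case (Suc m)
  have "d (Suc (n + m)) \<le> 2 * (C * (\<psi> (n + m) - \<psi> (Suc (n + m)))) + (d (n + m) - d (Suc (n + m))) / 2"
    by (rule finite_length_step) (use step[of "n + m"] d dec[of "n + m"] C n in auto)
  with Suc show ?case
    by (simp add: algebra_simps diff_divide_distrib)
qed simp

text \<open>The telescoped sums bound the path length uniformly, so the increments are absolutely
  summable and completeness yields a limit. Letting the endpoint of a tail tend to infinity gives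
  the distance bound.\<close>

lemma finite_length_convergent:
  fixes X :: "nat \<Rightarrow> 'a::banach" and \<psi> :: "nat \<Rightarrow> real"
  defines "d \<equiv> \<lambda>n. norm (X (Suc n) - X n)"
  assumes step: "\<And>n. N \<le> n \<Longrightarrow> (d (Suc n))\<^sup>2 \<le> C * (\<psi> n - \<psi> (Suc n)) * (d n + d (Suc n))"
    and dec: "\<And>n. N \<le> n \<Longrightarrow> \<psi> (Suc n) \<le> \<psi> n" and pos: "\<And>n. N \<le> n \<Longrightarrow> 0 \<le> \<psi> n" and C: "0 \<le> C"
  shows "convergent X"
    and "\<And>xs n. X \<longlonglongrightarrow> xs \<Longrightarrow> N \<le> n \<Longrightarrow> norm (X (Suc n) - xs) \<le> 2 * C * \<psi> n + d n / 2"
proof -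
  have d: "0 \<le> d n" for n
    by (simp add: d_def)
  have bound: "(\<Sum>i<m. d (Suc n + i)) \<le> 2 * C * \<psi> n + d n / 2" if "N \<le> n" for n m
  proof -
    have "0 \<le> C * \<psi> (n + m)"
      using C pos that by simp
    then show ?thesis
      using finite_length_sum[of N d C \<psi> n m, OF step d dec C that] d[of "n + m"]
      by (simp add: algebra_simps diff_divide_distrib)
  qed
  have "summable (\<lambda>i. d (i + Suc N))"
    using bound[of N] d by (intro summableI_nonneg_bounded) (auto simp: add.commute)
  then have "summable d"
    by (rule summable_iff_shift[THEN iffD1])
  then have "summable (\<lambda>n. X (Suc n) - X n)"
    unfolding d_def by (rule summable_norm_cancel)
  then have "convergent (\<lambda>n. (X n - X 0) + X 0)"
    unfolding summable_iff_convergent sum_lessThan_telescope by (intro convergent_add convergent_const)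
  then show "convergent X"
    by simp
  fix xs n assume lim: "X \<longlonglongrightarrow> xs" and n: "N \<le> n"
  have "norm (X (Suc n) - X (m + Suc n)) \<le> 2 * C * \<psi> n + d n / 2" for m
  proof -
    have "norm (X (Suc n) - X (m + Suc n)) = norm (\<Sum>i<m. X (Suc (i + Suc n)) - X (i + Suc n))"
      using sum_lessThan_telescope[of "\<lambda>i. X (i + Suc n)" m] by (simp add: norm_minus_commute)
    also have "\<dots> \<le> (\<Sum>i<m. d (Suc n + i))"
      unfolding d_def by (rule sum_norm_le) (simp add: add.commute)
    finally show ?thesis
      using bound[OF n, of m] by simp
  qed
  moreover have "(\<lambda>m. norm (X (Suc n) - X (m + Suc n))) \<longlonglongrightarrow> norm (X (Suc n) - xs)"
    by (intro tendsto_intros LIMSEQ_ignore_initial_segment[OF lim])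
  ultimately show "norm (X (Suc n) - xs) \<le> 2 * C * \<psi> n + d n / 2"
    by (intro LIMSEQ_le_const2) auto
qed

text \<open>Solving the recursion for \<open>h (Suc n)\<close> gives the contraction factor
  \<open>q\<close>; dividing by \<open>q ^ N\<close> normalises the bound at
  \<open>n = N\<close>.\<close>

lemma geometric_rate:
  fixes h :: "nat \<Rightarrow> real"
  assumes rec: "\<And>n. N \<le> n \<Longrightarrow> h (Suc n) \<le> C * (h n - h (Suc n))" and C: "0 < C" and n: "N \<le> n"
  defines "q \<equiv> C / (1 + C)"
  shows "h n \<le> q ^ n * (h N / q ^ N)"
  using n
proof (induction n rule: dec_induct)
  case base
  show ?case
    using C by (simp add: q_def)
next
  case (step n)
  have "h (Suc n) \<le> q * h n"
    using rec[of n] step.hyps C by (simp add: q_def field_simps)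
  also have "\<dots> \<le> q * (q ^ n * (h N / q ^ N))"
    using step.IH C by (intro mult_left_mono) (auto simp: q_def)
  finally show ?case
    by (simp add: mult.assoc)
qed

text \<open>The point \<open>1 + t\<close> lies between 1 and 2, where a convex power stays below
  its chord.\<close>

lemma powr_one_plus_le:
  fixes q t :: real
  assumes "1 \<le> q" "0 \<le> t" "t \<le> 1"
  shows "(1 + t) powr q \<le> 1 + (2 powr q - 1) * t"
proof -
  have "((1 - t) *\<^sub>R 1 + t *\<^sub>R 2) powr q \<le> (1 - t) * (1 powr q) + t * (2 powr q)"
    using convex_onD[OF powr_convex[OF assms(1)], of t 1 2] assms by auto
  then show ?thesis
    by (simp add: algebra_simps)
qed

text \<open>Induction against the comparison sequence \<open>B * real n powr (- q)\<close>. If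
  \<open>h (Suc k)\<close> exceeded it, the recursion would force \<open>h k\<close> above the
  comparison value at \<open>k\<close>, against the induction hypothesis.\<close>

lemma sublinear_rate:
  fixes h :: "nat \<Rightarrow> real"
  assumes rec: "\<And>n. N \<le> n \<Longrightarrow> h (Suc n) powr p \<le> C * (h n - h (Suc n))"
    and C: "0 < C" and p: "1 < p" "p < 2"
  shows "\<exists>B>0. \<forall>n\<ge>max N 1. h n \<le> B * real n powr (- (1 / (p - 1)))"
proof -
  define q where "q = 1 / (p - 1)"
  have q: "1 \<le> q" and qp: "q * (p - 1) = 1"
    using p by (auto simp: q_def)
  \<comment> \<open>Index 0 is excluded because \<open>0 powr (- q)\<close> is 0 and would make the
    bound vanish there.\<close>
  define N1 where "N1 = max N 1"
  define M where "M = 2 powr q - 1"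
  have M: "0 < M"
    using q powr_less_mono[of 0 q 2] by (auto simp: M_def)
  \<comment> \<open>The first entry settles the base case. The second gives
    \<open>2 * C * M \<le> B powr (p - 1)\<close>, which makes the drop forced by the recursion
    outweigh the growth of the comparison sequence from \<open>Suc k\<close> back to
    \<open>k\<close>.\<close>
  define B where "B = max (h N1 * real N1 powr q) ((2 * C * M) powr q)"
  have B: "0 < B" "h N1 * real N1 powr q \<le> B" "(2 * C * M) powr q \<le> B"
    using C M by (auto simp: B_def less_max_iff_disj)
  have "((2 * C * M) powr q) powr (p - 1) \<le> B powr (p - 1)"
    by (rule powr_mono2) (use B p in auto)
  then have Bp: "2 * C * M \<le> B powr (p - 1)"
    using C M by (simp add: powr_powr qp)
  have "h n \<le> B * real n powr (- q)" if "N1 \<le> n" for n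
    using that
  proof (induction n rule: dec_induct)
    case base
    show ?case
      using B by (simp add: N1_def powr_minus field_simps)
  next
    case (step k)
    have k: "1 \<le> real k" "N \<le> k"
      using step.hyps by (auto simp: N1_def)
    define y where "y = B * real (Suc k) powr (- q)"
    have y: "0 < y"
      using B by (simp add: y_def)
    show ?case
    proof (rule ccontr)
      assume "\<not> h (Suc k) \<le> B * real (Suc k) powr (- q)"
      then have hy: "y < h (Suc k)"
        by (simp add: y_def)
      then have "y powr p \<le> h (Suc k) powr p"
        using y p by (intro powr_mono2) auto
      also have "\<dots> \<le> C * (h k - h (Suc k))"
        by (rule rec) (rule k)
      finally have "y powr p / C \<le> h k - h (Suc k)"
        using C by (simp add: field_simps)
      with hy have hk: "y + y powr p / C < h k"
        by simp
      have "y powr (p - 1) = B powr (p - 1) * (real (Suc k) powr (- (q * (p - 1))))"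
        using B by (simp add: y_def powr_mult powr_powr)
      also have "\<dots> = B powr (p - 1) / real (Suc k)"
        by (simp add: qp powr_minus divide_inverse)
      also have "\<dots> \<ge> 2 * C * M / real (Suc k)"
        by (rule divide_right_mono) (use Bp in auto)
      finally have y1: "2 * C * M / real (Suc k) \<le> y powr (p - 1)" .
      \<comment> \<open>The spare factor 2 pays for \<open>Suc k \<le> 2 * k\<close>.\<close>
      have "C * M / real k \<le> 2 * C * M / real (Suc k)"
        using k C M by (simp add: field_simps)
      with y1 have "C * M / real k \<le> y powr (p - 1)"
        by linarith
      then have "M / real k \<le> y powr (p - 1) / C"
        using C by (simp add: field_simps)
      then have "y * (M / real k) \<le> y * (y powr (p - 1) / C)"
        using y by (intro mult_left_mono) auto
      also have "\<dots> = y powr p / C"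
        using y powr_add[of y 1 "p - 1"] by simp
      finally have *: "y * (1 + M * (1 / real k)) < h k"
        using hk by (simp add: algebra_simps)
      have "B * real k powr (- q) = y * ((real (Suc k) / real k) powr q)"
        using k by (simp add: y_def powr_divide powr_minus field_simps)
      also have "real (Suc k) / real k = 1 + 1 / real k"
        using k by (simp add: field_simps)
      also have "y * (1 + 1 / real k) powr q \<le> y * (1 + M * (1 / real k))"
        unfolding M_def using y k q by (intro mult_left_mono powr_one_plus_le) auto
      finally show False
        using * step.IH by simp
    qed
  qed
  then show ?thesis
    using B(1) unfolding q_def N1_def by blast
qed

text \<open>The rate argument in terms of real sequences only: \<open>h\<close> will be the merit
  gap, \<open>d\<close> the step length and \<open>e\<close> the distance to the limit.\<close>

lemma KL_rates:
  fixes h d e :: "nat \<Rightarrow> real"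
  assumes h: "\<And>n. N \<le> n \<Longrightarrow> 0 \<le> h n" and d: "\<And>n. 0 \<le> d n"
    and desc: "\<And>n. N \<le> n \<Longrightarrow> M * ((d n)\<^sup>2 + (d (Suc n))\<^sup>2) \<le> h n - h (Suc n)"
    and KL: "\<And>n. N \<le> n \<Longrightarrow> h (Suc n) powr \<theta> \<le> b * (d n + d (Suc n))"
    and e: "\<And>n. N \<le> n \<Longrightarrow> e (Suc n) \<le> A * h (Suc n) powr (1 - \<theta>) + d n / 2"
    and h0: "h \<longlonglongrightarrow> 0" and d0: "d \<longlonglongrightarrow> 0" and \<theta>: "0 \<le> \<theta>" "\<theta> < 1"
    and pos: "0 < M" "0 < b" "0 \<le> A"
  shows "\<theta> = 0 \<Longrightarrow> \<forall>\<^sub>F n in sequentially. e n \<le> 0"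
    and "0 < \<theta> \<Longrightarrow> \<theta> \<le> 1/2 \<Longrightarrow> \<exists>Q\<in>{0<..<1}. \<exists>c>0. \<forall>\<^sub>F n in sequentially. e n \<le> Q ^ n * c"
    and "1/2 < \<theta> \<Longrightarrow> \<exists>Q>0. \<forall>\<^sub>F n in sequentially. e n \<le> Q * real n powr (- ((1 - \<theta>) / (2 * \<theta> - 1)))"
proof -
  have "\<forall>\<^sub>F n in sequentially. h n < 1"
    using h0 by (rule order_tendstoD) simp
  then obtain K where K: "\<And>n. K \<le> n \<Longrightarrow> h n < 1"
    unfolding eventually_sequentially by blast
  define N1 where "N1 = max N K"
  have N1: "N \<le> n" "h n < 1" if "N1 \<le> n" for n
    using that K by (auto simp: N1_def)
  have dec: "h (Suc n) \<le> h n" if "N \<le> n" for n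
  proof -
    have "0 \<le> M * ((d n)\<^sup>2 + (d (Suc n))\<^sup>2)"
      using pos by simp
    with desc[OF that] show ?thesis by simp
  qed
  define C where "C = 2 * b\<^sup>2 / M"
  have C: "0 < C"
    using pos by (simp add: C_def)
  have rec: "h (Suc n) powr (2 * \<theta>) \<le> C * (h n - h (Suc n))" if "N \<le> n" for n
  proof -
    have "h (Suc n) powr (2 * \<theta>) = (h (Suc n) powr \<theta>)\<^sup>2"
      by (simp add: power2_eq_square flip: powr_add)
    also have "\<dots> \<le> (b * (d n + d (Suc n)))\<^sup>2"
      by (rule power_mono) (use KL[OF that] in auto)
    also have "\<dots> \<le> b\<^sup>2 * (2 * ((d n)\<^sup>2 + (d (Suc n))\<^sup>2))"
      unfolding power_mult_distrib using zero_le_power2[of "d n - d (Suc n)"]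
      by (intro mult_left_mono) (auto simp: power2_eq_square algebra_simps)
    also have "\<dots> = C * (M * ((d n)\<^sup>2 + (d (Suc n))\<^sup>2))"
      using pos by (simp add: C_def)
    also have "\<dots> \<le> C * (h n - h (Suc n))"
      using C desc[OF that] by (intro mult_left_mono) auto
    finally show ?thesis .
  qed
  \<comment> \<open>The second summand absorbs \<open>d n / 2\<close>, since descent gives
    \<open>d n \<le> sqrt (h n / M)\<close>.\<close>
  define A' where "A' = A + 1 / (2 * sqrt M)"
  have A': "0 < A'"
    using pos by (simp add: A'_def add_nonneg_pos)
  \<comment> \<open>As \<open>h n < 1\<close>, lowering an exponent only enlarges the power, so one
    exponent \<open>r\<close> can dominate both terms of the distance bound. It will be 1/2 for
    \<theta> up to 1/2, and \<open>1 - \<theta>\<close> beyond.\<close>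
  have e_le: "e (Suc n) \<le> A' * h n powr r" if n: "N1 \<le> n" and r: "0 \<le> r" "r \<le> 1 - \<theta>" "r \<le> 1/2" for n r
  proof -
    have h1: "0 \<le> h (Suc n)" "0 \<le> h n" "h n < 1" "h (Suc n) \<le> h n"
      using N1[OF n] h dec by auto
    have mono: "h n powr s \<le> h n powr r" if "r \<le> s" for s
      using h1 that by (cases "h n = 0") (auto intro: powr_mono')
    have "h (Suc n) powr (1 - \<theta>) \<le> h n powr (1 - \<theta>)"
      using h1 \<theta> by (intro powr_mono2) auto
    then have 1: "A * h (Suc n) powr (1 - \<theta>) \<le> A * h n powr r"
      using mono[of "1 - \<theta>"] r pos by (intro mult_left_mono) auto
    have "M * (d n)\<^sup>2 \<le> M * ((d n)\<^sup>2 + (d (Suc n))\<^sup>2)"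
      using pos by (intro mult_left_mono) auto
    then have "M * (d n)\<^sup>2 \<le> h n"
      using desc[OF N1(1)[OF n]] h1 by linarith
    then have "d n \<le> sqrt (h n / M)"
      using pos by (intro real_le_rsqrt) (simp add: field_simps)
    also have "\<dots> \<le> h n powr r / sqrt M"
      using mono[of "1/2"] r h1 pos by (simp add: real_sqrt_divide powr_half_sqrt divide_right_mono)
    finally have "d n / 2 \<le> h n powr r * (1 / (2 * sqrt M))"
      by simp
    with 1 e[OF N1(1)[OF n]] show ?thesis
      by (simp add: A'_def algebra_simps)
  qed
  {
    assume "\<theta> = 0"
    have "(\<lambda>n. b * (d n + d (Suc n))) \<longlonglongrightarrow> b * (0 + 0)"
      by (intro tendsto_intros d0 LIMSEQ_Suc)
    then have "\<forall>\<^sub>F n in sequentially. b * (d n + d (Suc n)) < 1"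
      by (rule order_tendstoD) simp
    \<comment> \<open>With \<theta> = 0 the left side of \<open>KL\<close> is 1 unless
      \<open>h (Suc n) = 0\<close>, where \<open>0 powr 0\<close> is 0 by convention. A right side
      below 1 therefore forces the gap to vanish.\<close>
    with eventually_ge_at_top[of N] have "\<forall>\<^sub>F n in sequentially. h (Suc n) = 0"
    proof eventually_elim
      case (elim n)
      then show ?case
        using KL[of n] h[of "Suc n"] \<open>\<theta> = 0\<close> by (auto split: if_splits)
    qed
    then have "\<forall>\<^sub>F n in sequentially. h n = 0"
      by (rule eventually_sequentially_Suc[THEN iffD1])
    with eventually_ge_at_top[of N1] have "\<forall>\<^sub>F n in sequentially. e (Suc n) \<le> 0"
      by eventually_elim (use e_le[of _ "1/2"] \<open>\<theta> = 0\<close> in force)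
    then show "\<forall>\<^sub>F n in sequentially. e n \<le> 0"
      by (rule eventually_sequentially_Suc[THEN iffD1])
  next
    assume \<theta>': "0 < \<theta>" "\<theta> \<le> 1/2"
    have "h (Suc n) \<le> C * (h n - h (Suc n))" if "N1 \<le> n" for n
    proof -
      \<comment> \<open>Here \<open>2 * \<theta> \<le> 1\<close> and the gap is below 1, so the
        recursion becomes linear.\<close>
      have "h (Suc n) powr 1 \<le> h (Suc n) powr (2 * \<theta>)"
        using h[of "Suc n"] dec[of n] N1[OF that] \<theta>' powr_mono'[of "2 * \<theta>" 1 "h (Suc n)"]
        by (cases "h (Suc n) = 0") auto
      then show ?thesis
        using rec[of n] N1[OF that] h[of "Suc n"] by simp
    qed
    from geometric_rate[of N1 h C, OF this C]
    have geo: "h n \<le> (C / (1 + C)) ^ n * (h N1 / (C / (1 + C)) ^ N1)" if "N1 \<le> n" for n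
      using that by blast
    define q where "q = C / (1 + C)"
    have q: "0 < q" "q < 1"
      using C by (auto simp: q_def)
    define c where "c = h N1 / q ^ N1"
    have c: "0 \<le> c"
      using q h[of N1] by (simp add: c_def N1_def)
    define Q where "Q = sqrt q"
    have Q: "0 < Q" "Q < 1"
      using q by (auto simp: Q_def)
    \<comment> \<open>The distance scales like the square root of the gap, hence
      \<open>Q = sqrt q\<close>. The added 1 keeps the constant positive when \<open>c = 0\<close>;
      dividing by \<open>Q\<close> accounts for the shift to \<open>Suc n\<close>.\<close>
    have "e (Suc n) \<le> Q ^ Suc n * (A' * sqrt c / Q + 1)" if n: "N1 \<le> n" for n
    proof -
      have "e (Suc n) \<le> A' * sqrt (h n)"
        using e_le[OF n, of "1/2"] \<theta>' h[of n] N1[OF n] by (simp add: powr_half_sqrt)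
      also have "\<dots> \<le> A' * sqrt (q ^ n * c)"
        using geo[OF n] A' unfolding q_def[symmetric] c_def by (intro mult_left_mono) auto
      also have "\<dots> = Q ^ Suc n * (A' * sqrt c / Q)"
        using Q by (simp add: Q_def real_sqrt_mult real_sqrt_power)
      also have "\<dots> \<le> Q ^ Suc n * (A' * sqrt c / Q + 1)"
        using Q by (intro mult_left_mono) auto
      finally show ?thesis .
    qed
    then have "\<forall>\<^sub>F n in sequentially. e (Suc n) \<le> Q ^ Suc n * (A' * sqrt c / Q + 1)"
      unfolding eventually_sequentially by blast
    then have "\<forall>\<^sub>F n in sequentially. e n \<le> Q ^ n * (A' * sqrt c / Q + 1)"
      by (rule eventually_sequentially_Suc[THEN iffD1])
    moreover have "0 < A' * sqrt c / Q + 1"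
      using A' Q c by (intro add_nonneg_pos) auto
    ultimately show "\<exists>Q\<in>{0<..<1}. \<exists>c>0. \<forall>\<^sub>F n in sequentially. e n \<le> Q ^ n * c"
      using Q by (intro bexI[of _ Q] exI[of _ "A' * sqrt c / Q + 1"]) auto
  next
    assume \<theta>': "1/2 < \<theta>"
    obtain B where B: "0 < B" "\<And>n. max N 1 \<le> n \<Longrightarrow> h n \<le> B * real n powr (- (1 / (2 * \<theta> - 1)))"
      using sublinear_rate[of N h "2 * \<theta>" C, OF rec C] \<theta> \<theta>' by auto
    define s where "s = (1 - \<theta>) / (2 * \<theta> - 1)"
    have s: "0 < s"
      using \<theta> \<theta>' by (simp add: s_def)
    \<comment> \<open>The factor \<open>2 powr s\<close> passes from \<open>n\<close> to
      \<open>Suc n\<close>, using \<open>Suc n / 2 \<le> n\<close>.\<close>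
    define Q where "Q = A' * B powr (1 - \<theta>) * 2 powr s"
    have "e (Suc n) \<le> Q * real (Suc n) powr (- s)" if n: "max N1 1 \<le> n" for n
    proof -
      have n1: "N1 \<le> n" "max N 1 \<le> n" "1 \<le> real n"
        using n by (auto simp: N1_def)
      have "e (Suc n) \<le> A' * h n powr (1 - \<theta>)"
        using e_le[OF n1(1), of "1 - \<theta>"] \<theta>' \<theta> by simp
      also have "\<dots> \<le> A' * (B * real n powr (- (1 / (2 * \<theta> - 1)))) powr (1 - \<theta>)"
        using B(2)[OF n1(2)] A' h[of n] n1 \<theta> by (intro mult_left_mono powr_mono2) auto
      also have "\<dots> = A' * B powr (1 - \<theta>) * real n powr (- s)"
        using B(1) by (simp add: powr_mult powr_powr s_def)
      also have "real n powr (- s) \<le> (real (Suc n) / 2) powr (- s)"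
        using n1 s by (intro powr_mono2') auto
      also have "\<dots> = 2 powr s * real (Suc n) powr (- s)"
        by (simp add: powr_divide powr_minus field_simps)
      finally show ?thesis
        using A' by (simp add: Q_def mult_left_mono mult.assoc)
    qed
    then have "\<forall>\<^sub>F n in sequentially. e (Suc n) \<le> Q * real (Suc n) powr (- s)"
      unfolding eventually_sequentially by blast
    then have "\<forall>\<^sub>F n in sequentially. e n \<le> Q * real n powr (- s)"
      by (rule eventually_sequentially_Suc[THEN iffD1])
    moreover have "0 < Q"
      using A' B by (simp add: Q_def)
    ultimately show "\<exists>Q>0. \<forall>\<^sub>F n in sequentially. e n \<le> Q * real n powr (- ((1 - \<theta>) / (2 * \<theta> - 1)))"
      unfolding s_def by blast
  }
qed

subsection \<open>The forward-reflected-backward iteration\<close>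

lemma Prox_le:
  assumes "y \<in> Prox lam f w"
  shows "f y + ereal (1 / (2 * lam) * (norm (w - y))\<^sup>2) \<le> f u + ereal (1 / (2 * lam) * (norm (w - u))\<^sup>2)"
  using assms by (auto simp: Prox_def is_arg_min_def not_less)

lemma Prox_finite:
  assumes "y \<in> Prox lam f w" and "proper_fun f"
  shows "\<bar>f y\<bar> \<noteq> \<infinity>"
proof -
  obtain u where "f u \<noteq> \<infinity>"
    using assms(2) by (auto simp: proper_fun_def)
  with Prox_le[OF assms(1), of u] assms(2) show ?thesis
    by (cases "f y"; cases "f u") (auto simp: proper_fun_def)
qed

text \<open>Completing the square isolates a term independent of \<open>u\<close>, which drops out
  when values of the prox objective are compared.\<close>

lemma prox_quadratic_expand:
  fixes x e u :: "'a::real_inner"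
  assumes "lam \<noteq> 0"
  shows "1 / (2 * lam) * (norm (x + lam *\<^sub>R e - u))\<^sup>2
    = lam / 2 * (norm e)\<^sup>2 + (1 / (2 * lam) * (norm (u - x))\<^sup>2 - e \<bullet> (u - x))"
proof -
  have "(norm (x + lam *\<^sub>R e - u))\<^sup>2 = (norm (lam *\<^sub>R e - (u - x)))\<^sup>2"
    by (simp add: algebra_simps)
  also have "\<dots> = lam\<^sup>2 * (norm e)\<^sup>2 - 2 * lam * (e \<bullet> (u - x)) + (norm (u - x))\<^sup>2"
    unfolding power2_norm_eq_inner
    by (simp add: inner_diff_left inner_diff_right inner_commute power2_eq_square algebra_simps)
  finally have *: "(norm (x + lam *\<^sub>R e - u))\<^sup>2 = \<dots>" .
  show ?thesis
    unfolding * using assms by (simp add: field_simps power2_eq_square)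
qed

text \<open>Otherwise infinitely many terms lie in the closed complement of \<open>U\<close>, and by
  compactness a subsequence of them converges to a point there.\<close>

lemma bounded_eventually_in_open:
  fixes Z :: "nat \<Rightarrow> 'a::heine_borel"
  assumes bdd: "bounded (range Z)" and U: "open U"
    and sub: "\<And>r p. strict_mono r \<Longrightarrow> (\<lambda>j. Z (r j)) \<longlonglongrightarrow> p \<Longrightarrow> p \<in> U"
  shows "\<forall>\<^sub>F n in sequentially. Z n \<in> U"
proof (rule ccontr)
  assume "\<not> ?thesis"
  then have inf: "infinite {n. Z n \<notin> U}"
    by (simp add: eventually_cofinite flip: cofinite_eq_sequentially)
  define s where "s = enumerate {n. Z n \<notin> U}"
  have s: "strict_mono s" "\<And>j. Z (s j) \<notin> U"
    using strict_mono_enumerate[OF inf] enumerate_in_set[OF inf] by (auto simp: s_def)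
  have "bounded (range (Z \<circ> s))"
    using bdd by (rule bounded_subset) auto
  then obtain p r where r: "strict_mono r" "((Z \<circ> s) \<circ> r) \<longlonglongrightarrow> p"
    using bounded_imp_convergent_subsequence by blast
  have "p \<in> U"
    using sub[OF strict_mono_o[OF s(1) r(1)]] r(2) by (simp add: o_def)
  moreover have "p \<in> - U"
    by (rule Lim_in_closed_set[of "- U" _ sequentially, OF _ _ _ r(2)]) (use U s(2) in auto)
  ultimately show False
    by simp
qed

text \<open>The iteration on natural indices from 0 on. The prox step that produces
  \<open>x 1\<close> from the iterate at index -1 is dropped, which is harmless for asymptotic
  claims, so finiteness of \<open>f\<close> along the iterates is available from index 2.\<close>

locale FRB_iteration =
  fixes f :: "'a::euclidean_space \<Rightarrow> ereal" and g :: "'a \<Rightarrow> real" and G :: "'a \<Rightarrow> 'a"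
    and L lam :: real and x :: "nat \<Rightarrow> 'a"
  assumes proper: "proper_fun f" and lsc: "lsc f"
    and grad: "\<And>u. GDERIV g u :> G u" and lip: "L-lipschitz_on UNIV G"
    and L_pos: "0 < L" and lam_pos: "0 < lam" and lam_less: "lam < 1 / (4 * L)"
    and prox: "\<And>n. x (Suc (Suc n)) \<in> Prox lam f
      (x (Suc n) + lam *\<^sub>R (G (x n) - G (x (Suc n))) - lam *\<^sub>R G (x (Suc n)))"
begin

definition d :: "nat \<Rightarrow> real" where
  "d n = norm (x (Suc n) - x n)"

text \<open>Chosen so that the centre of the prox step is
  \<open>x (Suc n) + lam *\<^sub>R e n\<close>.\<close>

definition e :: "nat \<Rightarrow> 'a" where
  "e n = G (x n) - 2 *\<^sub>R G (x (Suc n))"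

text \<open>Up to a constant, \<open>f + P n\<close> is the function minimised by \<open>x (Suc (Suc n))\<close>.\<close>

definition P :: "nat \<Rightarrow> 'a \<Rightarrow> real" where
  "P n u = 1 / (2 * lam) * (norm (u - x (Suc n)))\<^sup>2 - e n \<bullet> (u - x (Suc n))"

definition F :: "nat \<Rightarrow> real" where
  "F n = real_of_ereal (f (x n))"

text \<open>For \<open>n \<ge> 1\<close> this is the merit value at \<open>(x (Suc n), x n)\<close>; for \<open>n = 0\<close> it may be junk,
  since \<open>f (x 1)\<close> need not be finite in this locale.\<close>

definition Hv :: "nat \<Rightarrow> real" where
  "Hv n = F (Suc n) + g (x (Suc n)) + 1 / (4 * lam) * (norm (x (Suc n) - x n))\<^sup>2"

definition M1 :: real where
  "M1 = 1 / (4 * lam) - L"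

definition M2 :: real where
  "M2 = 1 / lam + L"

section \<open>Descent and subgradient bounds for the merit function\<close>

lemma M1_pos: "0 < M1"
  using lam_less lam_pos L_pos by (simp add: M1_def field_simps)

lemma M2_pos: "0 < M2"
  using lam_pos L_pos by (simp add: M2_def add_pos_pos)

lemma d_nonneg: "0 \<le> d n"
  by (simp add: d_def)

lemma f_x: "f (x (Suc (Suc n))) = ereal (F (Suc (Suc n)))"
  using Prox_finite[OF prox proper] by (simp add: F_def ereal_real')

lemma H_x: "FRB_merit lam f g (x (Suc (Suc n)), x (Suc n)) = ereal (Hv (Suc n))"
  by (simp add: FRB_merit_def Hv_def f_x)

lemma prox_step: "f (x (Suc (Suc n))) + ereal (P n (x (Suc (Suc n)))) \<le> f u + ereal (P n u)"
proof -
  have eq: "x (Suc n) + lam *\<^sub>R (G (x n) - G (x (Suc n))) - lam *\<^sub>R G (x (Suc n)) = x (Suc n) + lam *\<^sub>R e n"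
    by (simp add: e_def algebra_simps flip: scaleR_2)
  have "1 / (2 * lam) * (norm (x (Suc n) + lam *\<^sub>R e n - u))\<^sup>2 = lam / 2 * (norm (e n))\<^sup>2 + P n u" for u
    unfolding P_def by (rule prox_quadratic_expand) (use lam_pos in simp)
  with Prox_le[OF prox[of n, unfolded eq], of u] show ?thesis
    unfolding f_x by (cases "f u") auto
qed

text \<open>Add the prox comparison with \<open>u = x (Suc m)\<close> to the descent lemma at that
  point. Because \<open>e m + G (x (Suc m))\<close> is a difference of two gradients, the linear
  terms leave only a cross term of size \<open>L * d m * d (Suc m)\<close>. Half of the prox
  quadratic is spent on the merit term, the other half on \<open>M1\<close>.\<close>

lemma descent: "M1 * ((d (Suc n))\<^sup>2 + (d (Suc (Suc n)))\<^sup>2) \<le> Hv (Suc n) - Hv (Suc (Suc n))"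
proof -
  \<comment> \<open>Shifting by one makes \<open>f\<close> finite at the comparison point
    \<open>x (Suc m)\<close>.\<close>
  define m where "m = Suc n"
  define \<delta> where "\<delta> = x (Suc (Suc m)) - x (Suc m)"
  have dm: "norm \<delta> = d (Suc m)"
    by (simp add: \<delta>_def d_def)
  have "F (Suc (Suc m)) + 1 / (2 * lam) * (d (Suc m))\<^sup>2 - e m \<bullet> \<delta> \<le> F (Suc m)"
    using prox_step[of m "x (Suc m)"] by (simp add: m_def P_def \<delta>_def d_def f_x)
  moreover have "g (x (Suc (Suc m))) \<le> g (x (Suc m)) + G (x (Suc m)) \<bullet> \<delta> + L / 2 * (d (Suc m))\<^sup>2"
    using lipschitz_gradient_descent[OF grad lip] by (simp add: \<delta>_def d_def)
  moreover have "e m \<bullet> \<delta> + G (x (Suc m)) \<bullet> \<delta> \<le> L * d m * d (Suc m)"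
  proof -
    have "e m \<bullet> \<delta> + G (x (Suc m)) \<bullet> \<delta> = (G (x m) - G (x (Suc m))) \<bullet> \<delta>"
      by (simp add: e_def inner_diff_left)
    also have "\<dots> \<le> norm (G (x m) - G (x (Suc m))) * norm \<delta>"
      by (rule norm_cauchy_schwarz)
    also have "\<dots> \<le> (L * d m) * d (Suc m)"
      using lipschitz_onD[OF lip, of "x m" "x (Suc m)"]
      using L_pos by (intro mult_mono) (auto simp: dm d_def dist_norm norm_minus_commute)
    finally show ?thesis .
  qed
  moreover have "L * d m * d (Suc m) \<le> L * (((d m)\<^sup>2 + (d (Suc m))\<^sup>2) / 2)"
    unfolding mult.assoc using L_pos zero_le_power2[of "d m - d (Suc m)"]
    by (intro mult_left_mono) (auto simp: power2_eq_square field_simps)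
  \<comment> \<open>The loss on \<open>(d m)\<^sup>2\<close> is only \<open>L / 2\<close>; weakening
    it to \<open>L\<close> gives both squares the coefficient \<open>M1\<close>.\<close>
  moreover have "0 \<le> L * (d m)\<^sup>2"
    using L_pos by simp
  moreover have "1 / (2 * lam) * (d (Suc m))\<^sup>2 = 1 / (4 * lam) * (d (Suc m))\<^sup>2 + 1 / (4 * lam) * (d (Suc m))\<^sup>2"
    by (simp add: field_simps)
  ultimately have "M1 * ((d m)\<^sup>2 + (d (Suc m))\<^sup>2) \<le> Hv m - Hv (Suc m)"
    by (simp add: Hv_def M1_def algebra_simps flip: d_def)
  then show ?thesis
    by (simp add: m_def)
qed

lemma d_square_le: "M1 * (d (Suc n))\<^sup>2 \<le> Hv (Suc n) - Hv (Suc (Suc n))"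
proof -
  have "M1 * (d (Suc n))\<^sup>2 \<le> M1 * ((d (Suc n))\<^sup>2 + (d (Suc (Suc n)))\<^sup>2)"
    using M1_pos by (intro mult_left_mono) auto
  with descent[of n] show ?thesis by simp
qed

lemma Hv_dec: "Hv (Suc (Suc n)) \<le> Hv (Suc n)"
proof -
  have "0 \<le> M1 * (d (Suc n))\<^sup>2"
    using M1_pos by simp
  with d_square_le[of n] show ?thesis by simp
qed

lemma Hv_decseq: "decseq (\<lambda>n. Hv (Suc n))"
  by (intro decseq_SucI Hv_dec)

text \<open>Prox minimality says that \<open>f\<close> lies above a constant minus
  \<open>P n\<close>, with equality at the new iterate. Adding the smooth parts of the merit
  function gives the minorant \<open>S\<close>, touching it at \<open>p\<close>, whose gradient is
  \<open>(v1, v2)\<close>.\<close>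

lemma subgradient:
  obtains v where "v \<in> limiting_subdiff (FRB_merit lam f g) (x (Suc (Suc n)), x (Suc n))"
    and "norm v \<le> M2 * (d n + d (Suc n))"
proof -
  define \<delta> where "\<delta> = x (Suc (Suc n)) - x (Suc n)"
  define p where "p = (x (Suc (Suc n)), x (Suc n))"
  define S where "S q = F (Suc (Suc n)) + P n (x (Suc (Suc n))) - P n (fst q) + g (fst q)
    + 1 / (4 * lam) * (norm (fst q - snd q))\<^sup>2" for q :: "'a \<times> 'a"
  define v1 where "v1 = - (1 / lam) *\<^sub>R \<delta> + e n + G (x (Suc (Suc n))) + (1 / (2 * lam)) *\<^sub>R \<delta>"
  define v2 where "v2 = - (1 / (2 * lam)) *\<^sub>R \<delta>"
  have dg: "((\<lambda>q. g (fst q)) has_derivative (\<lambda>h. fst h \<bullet> G (x (Suc (Suc n))))) (at p)"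
    by (rule has_derivative_compose[where f=fst and f'=fst and g=g])
      (use grad[of "x (Suc (Suc n))"] in \<open>auto simp: gderiv_def p_def intro!: derivative_eq_intros\<close>)
  have dn: "((\<lambda>q. (norm (l q))\<^sup>2) has_derivative (\<lambda>h. 2 * (l p \<bullet> l' h))) (at p)"
    if "(l has_derivative l') (at p)" for l l' :: "'a \<times> 'a \<Rightarrow> 'a"
    unfolding power2_norm_eq_inner
    by (rule derivative_eq_intros that refl)+ (simp add: inner_commute fun_eq_iff)
  have "(S has_derivative (\<lambda>h. (v1, v2) \<bullet> h)) (at p)"
    unfolding S_def P_def
    by ((rule dn dg derivative_eq_intros refl)+, rule ext)
      (use lam_pos in \<open>simp add: p_def v1_def v2_def inner_prod_def inner_add_left inner_diff_left
        inner_add_right inner_diff_right inner_commute \<delta>_def field_simps\<close>)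
  moreover have "FRB_merit lam f g p = ereal (S p)"
    by (simp add: p_def S_def H_x Hv_def)
  moreover have "ereal (S q) \<le> FRB_merit lam f g q" for q
    using prox_step[of n "fst q"] unfolding f_x
    by (cases q; cases "f (fst q)") (auto simp: S_def FRB_merit_def)
  ultimately have "(v1, v2) \<in> frechet_subdiff (FRB_merit lam f g) p"
    by (rule frechet_subdiff_smooth_minorant)
  then have "(v1, v2) \<in> limiting_subdiff (FRB_merit lam f g) p"
    using frechet_subset_limiting_subdiff by blast
  moreover have "norm (v1, v2) \<le> M2 * (d n + d (Suc n))"
  proof -
    \<comment> \<open>Regrouped into gradient differences over consecutive iterates, so that every
      term is controlled by a step length. The two contributions \<open>1 / (2 * lam)\<close> from
      \<open>v1\<close> and \<open>v2\<close> add up to the \<open>1 / lam\<close> in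
      \<open>M2\<close>.\<close>
    have "v1 = - (1 / (2 * lam)) *\<^sub>R \<delta> + (G (x (Suc (Suc n))) - G (x (Suc n))) + (G (x n) - G (x (Suc n)))"
      unfolding v1_def e_def scaleR_2 by (simp add: algebra_simps flip: scaleR_add_left)
    then have "norm v1 \<le> norm (- (1 / (2 * lam)) *\<^sub>R \<delta>) + norm (G (x (Suc (Suc n))) - G (x (Suc n)))
        + norm (G (x n) - G (x (Suc n)))"
      by (metis norm_triangle_mono norm_triangle_ineq order_refl)
    also have "norm (G (x (Suc (Suc n))) - G (x (Suc n))) \<le> L * d (Suc n)"
      using lipschitz_onD[OF lip, of "x (Suc (Suc n))" "x (Suc n)"] by (simp add: d_def dist_norm)
    also have "norm (G (x n) - G (x (Suc n))) \<le> L * d n"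
      using lipschitz_onD[OF lip, of "x n" "x (Suc n)"] by (simp add: d_def dist_norm norm_minus_commute)
    finally have "norm v1 \<le> 1 / (2 * lam) * d (Suc n) + L * d (Suc n) + L * d n"
      using lam_pos by (simp add: \<delta>_def d_def)
    moreover have "norm v2 = 1 / (2 * lam) * d (Suc n)"
      using lam_pos by (simp add: v2_def \<delta>_def d_def)
    moreover have "norm (v1, v2) \<le> norm v1 + norm v2"
      by (rule norm_Pair_le)
    moreover have "0 \<le> 1 / lam * d n" "1 / lam * d (Suc n) = 1 / (2 * lam) * d (Suc n) + 1 / (2 * lam) * d (Suc n)"
      using lam_pos d_nonneg by (auto simp: field_simps)
    ultimately show ?thesis
      by (simp add: M2_def algebra_simps)
  qed
  ultimately show ?thesis
    using that by (simp add: p_def)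
qed

section \<open>The KL inequality along the iterates\<close>

lemma KL_ineq_subgradient:
  assumes KL: "KL_ineq (FRB_merit lam f g) \<mu> U \<eta> \<phi>" and U: "(x (Suc (Suc n)), x (Suc n)) \<in> U"
    and pos: "0 < Hv (Suc n) - \<mu>" and less: "ereal (Hv (Suc n) - \<mu>) < \<eta>"
  shows "1 \<le> left_deriv \<phi> (Hv (Suc n) - \<mu>) * (M2 * (d n + d (Suc n)))"
    and "0 \<le> left_deriv \<phi> (Hv (Suc n) - \<mu>)"
proof -
  define D where "D = left_deriv \<phi> (Hv (Suc n) - \<mu>)"
  let ?E = "edist_set 0 (limiting_subdiff (FRB_merit lam f g) (x (Suc (Suc n)), x (Suc n)))"
  obtain v where v: "v \<in> limiting_subdiff (FRB_merit lam f g) (x (Suc (Suc n)), x (Suc n))"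
    "norm v \<le> M2 * (d n + d (Suc n))"
    by (rule subgradient)
  have *: "1 \<le> ereal D * ?E"
    using KL U pos less unfolding KL_ineq_def D_def by (force simp: H_x)
  have E0: "0 \<le> ?E"
    unfolding edist_set_def by (rule INF_greatest) simp
  \<comment> \<open>The sign follows from the inequality itself: the distance is nonnegative, so a
    negative derivative could not bring the product up to 1. It allows the distance to be replaced
    by the bound on \<open>norm v\<close>.\<close>
  show D: "0 \<le> left_deriv \<phi> (Hv (Suc n) - \<mu>)"
  proof (rule ccontr)
    assume "\<not> ?thesis"
    then have "ereal D * ?E \<le> 0"
      using E0 by (simp add: D_def ereal_mult_le_0_iff)
    with * have "1 \<le> (0 :: ereal)"
      by (rule order_trans)
    then show False by simp
  qed
  have "?E \<le> ereal (dist 0 v)"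
    unfolding edist_set_def using v(1) by (rule INF_lower)
  also have "\<dots> \<le> ereal (M2 * (d n + d (Suc n)))"
    using v(2) by simp
  finally have "ereal D * ?E \<le> ereal D * ereal (M2 * (d n + d (Suc n)))"
    using D by (intro ereal_mult_left_mono) (auto simp: D_def)
  with * have "1 \<le> ereal D * ereal (M2 * (d n + d (Suc n)))"
    by (rule order_trans)
  then show "1 \<le> left_deriv \<phi> (Hv (Suc n) - \<mu>) * (M2 * (d n + d (Suc n)))"
    by (simp add: D_def one_ereal_def)
qed

text \<open>Multiply the merit drop by the KL bound, which is at least 1, turn the derivative times
  the drop into a \<phi>-difference by \<open>tangent\<close>, and bound the drop below by descent.
  If the gap is already zero, descent forces \<open>d (Suc n) = 0\<close>.\<close>

lemma KL_length_step:
  assumes KL: "KL_ineq (FRB_merit lam f g) \<mu> U \<eta> \<phi>" and U: "(x (Suc (Suc n)), x (Suc n)) \<in> U"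
    and ge: "\<And>n. \<mu> \<le> Hv (Suc n)" and less: "ereal (Hv (Suc n) - \<mu>) < \<eta>"
    and tangent: "\<And>t s. 0 < t \<Longrightarrow> ereal t < \<eta> \<Longrightarrow> 0 \<le> s \<Longrightarrow> s \<le> t \<Longrightarrow>
      left_deriv \<phi> t * (t - s) \<le> \<phi> t - \<phi> s"
  shows "(d (Suc n))\<^sup>2 \<le> M2 / M1 * (\<phi> (Hv (Suc n) - \<mu>) - \<phi> (Hv (Suc (Suc n)) - \<mu>)) * (d n + d (Suc n))"
    and "\<phi> (Hv (Suc (Suc n)) - \<mu>) \<le> \<phi> (Hv (Suc n) - \<mu>)"
proof -
  define h h' where "h = Hv (Suc n) - \<mu>" and "h' = Hv (Suc (Suc n)) - \<mu>"
  have h: "0 \<le> h'" "h' \<le> h"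
    using ge[of n] ge[of "Suc n"] Hv_dec[of n] by (auto simp: h_def h'_def)
  have desc: "M1 * (d (Suc n))\<^sup>2 \<le> h - h'"
    using d_square_le[of n] by (simp add: h_def h'_def)
  have "(d (Suc n))\<^sup>2 \<le> M2 / M1 * (\<phi> h - \<phi> h') * (d n + d (Suc n)) \<and> \<phi> h' \<le> \<phi> h"
  proof (cases "h = 0")
    case True
    with h have "h' = 0" by simp
    with True desc M1_pos show ?thesis
      by (simp add: mult_le_0_iff)
  next
    case False
    with h have h_pos: "0 < h" by simp
    define D where "D = left_deriv \<phi> h"
    have D: "1 \<le> D * (M2 * (d n + d (Suc n)))" "0 \<le> D"
      using KL_ineq_subgradient[OF KL U _ less] h_pos by (auto simp: h_def D_def)
    have tan: "D * (h - h') \<le> \<phi> h - \<phi> h'"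
      unfolding D_def using h h_pos less by (intro tangent) (auto simp: h_def)
    have "h - h' = 1 * (h - h')"
      by simp
    also have "\<dots> \<le> (D * (M2 * (d n + d (Suc n)))) * (h - h')"
      using D h by (intro mult_right_mono) auto
    also have "\<dots> = (D * (h - h')) * (M2 * (d n + d (Suc n)))"
      by (simp add: mult_ac)
    also have "\<dots> \<le> (\<phi> h - \<phi> h') * (M2 * (d n + d (Suc n)))"
      using tan M2_pos d_nonneg by (intro mult_right_mono) auto
    finally have "M1 * (d (Suc n))\<^sup>2 \<le> (\<phi> h - \<phi> h') * (M2 * (d n + d (Suc n)))"
      using desc by simp
    then have "(d (Suc n))\<^sup>2 \<le> M2 / M1 * (\<phi> h - \<phi> h') * (d n + d (Suc n))"
      using M1_pos by (simp add: field_simps)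
    moreover have "0 \<le> D * (h - h')"
      using D h by simp
    ultimately show ?thesis
      using tan by simp
  qed
  then show "(d (Suc n))\<^sup>2 \<le> M2 / M1 * (\<phi> (Hv (Suc n) - \<mu>) - \<phi> (Hv (Suc (Suc n)) - \<mu>)) * (d n + d (Suc n))"
    and "\<phi> (Hv (Suc (Suc n)) - \<mu>) \<le> \<phi> (Hv (Suc n) - \<mu>)"
    by (auto simp: h_def h'_def)
qed

section \<open>The limit of the merit values\<close>

lemma Hv_ge_limit_point:
  assumes r: "strict_mono r" and lim: "(\<lambda>j. x (Suc (r j))) \<longlonglongrightarrow> p" "(\<lambda>j. x (r j)) \<longlonglongrightarrow> q"
    and \<mu>: "FRB_merit lam f g (p, q) = ereal \<mu>"
  shows "\<mu> \<le> Hv (Suc n)"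
proof -
  obtain Fp where fp: "f p = ereal Fp"
    using \<mu> by (cases "f p") (auto simp: FRB_merit_def)
  have \<mu>_eq: "\<mu> = Fp + g p + 1 / (4 * lam) * (norm (p - q))\<^sup>2"
    using \<mu> by (simp add: FRB_merit_def fp)
  have g_cont: "isCont g p"
    using grad[of p] unfolding gderiv_def by (rule has_derivative_continuous)
  \<comment> \<open>Lower semicontinuity bounds the merit values along the subsequence from below up
    to \<epsilon>; since the values decrease, \<open>Hv (Suc n)\<close> dominates all late
    ones.\<close>
  have "\<mu> \<le> Hv (Suc n) + \<epsilon>" if "0 < \<epsilon>" for \<epsilon>
  proof -
    have less: "ereal (Fp - \<epsilon>) < f p"
      using that by (simp add: fp)
    also have "f p \<le> Liminf (at p) f"
      using lsc by (simp add: lsc_def)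
    finally have "\<forall>\<^sub>F u in at p. ereal (Fp - \<epsilon>) < f u"
      by (rule less_LiminfD)
    \<comment> \<open>\<open>lsc\<close> speaks of punctured neighbourhoods, so the point
      \<open>p\<close> itself, which the iterates may hit, is added by \<open>less\<close>.\<close>
    with less have "\<forall>\<^sub>F u in nhds p. ereal (Fp - \<epsilon>) < f u"
      by (simp add: eventually_nhds_conv_at)
    then have "\<forall>\<^sub>F j in sequentially. ereal (Fp - \<epsilon>) < f (x (Suc (r j)))"
      using lim(1) by (rule eventually_compose_filterlim)
    moreover have "\<forall>\<^sub>F j in sequentially. Suc n \<le> j"
      by (rule eventually_ge_at_top)
    ultimately have "\<forall>\<^sub>F j in sequentially.
      Fp - \<epsilon> + g (x (Suc (r j))) + 1 / (4 * lam) * (norm (x (Suc (r j)) - x (r j)))\<^sup>2 \<le> Hv (Suc n)"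
    proof eventually_elim
      case (elim j)
      have "Suc n \<le> r j"
        using seq_suble[OF r, of j] elim(2) by simp
      then obtain k where k: "r j = Suc k" "n \<le> k"
        by (cases "r j") auto
      have "Hv (r j) \<le> Hv (Suc n)"
        using decseqD[OF Hv_decseq k(2)] k by simp
      moreover have "Fp - \<epsilon> < F (Suc (r j))"
        using elim(1) f_x[of k] k by simp
      ultimately show ?case
        by (simp add: Hv_def)
    qed
    moreover have "(\<lambda>j. Fp - \<epsilon> + g (x (Suc (r j))) + 1 / (4 * lam) * (norm (x (Suc (r j)) - x (r j)))\<^sup>2)
        \<longlonglongrightarrow> Fp - \<epsilon> + g p + 1 / (4 * lam) * (norm (p - q))\<^sup>2"
      by (intro tendsto_intros lim isCont_tendsto_compose[OF g_cont])
    ultimately have "Fp - \<epsilon> + g p + 1 / (4 * lam) * (norm (p - q))\<^sup>2 \<le> Hv (Suc n)"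
      by (intro tendsto_upperbound) auto
    then show ?thesis
      by (simp add: \<mu>_eq)
  qed
  then show ?thesis
    by (rule field_le_epsilon)
qed

lemma d_tendsto_0:
  assumes "\<And>n. \<mu> \<le> Hv (Suc n)"
  shows "d \<longlonglongrightarrow> 0"
proof -
  obtain l where l: "(\<lambda>n. Hv (Suc n)) \<longlonglongrightarrow> l"
    using decseq_convergent[OF Hv_decseq, of \<mu>] assms by blast
  have lim: "(\<lambda>n. (Hv (Suc n) - Hv (Suc (Suc n))) / M1) \<longlonglongrightarrow> (l - l) / M1"
    using M1_pos by (intro tendsto_intros l LIMSEQ_Suc[OF l]) auto
  have "(d (Suc n))\<^sup>2 \<le> (Hv (Suc n) - Hv (Suc (Suc n))) / M1" for n
    using d_square_le[of n] M1_pos by (simp add: field_simps)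
  then have "(\<lambda>n. (d (Suc n))\<^sup>2) \<longlonglongrightarrow> 0"
    using lim by (intro tendsto_sandwich[OF _ _ tendsto_const lim[simplified]]) auto
  then have "(\<lambda>n. d (Suc n)) \<longlonglongrightarrow> 0"
    by simp
  then show ?thesis
    by (rule LIMSEQ_imp_Suc)
qed

text \<open>Lower semicontinuity gives only one inequality. The other compares the prox step with
  the limit point \<open>p\<close>: as consecutive iterates merge, both \<open>P\<close> terms
  vanish in the limit and the merit values are at most \<open>Fp + g p\<close>
  asymptotically.\<close>

lemma Hv_tendsto:
  assumes r: "strict_mono r" and lim: "(\<lambda>j. x (Suc (r j))) \<longlonglongrightarrow> p" "(\<lambda>j. x (r j)) \<longlonglongrightarrow> q"
    and \<mu>: "FRB_merit lam f g (p, q) = ereal \<mu>"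
  shows "(\<lambda>n. Hv (Suc n)) \<longlonglongrightarrow> \<mu>"
proof -
  have ge: "\<mu> \<le> Hv (Suc n)" for n
    by (rule Hv_ge_limit_point[OF assms])
  obtain l where l: "(\<lambda>n. Hv (Suc n)) \<longlonglongrightarrow> l"
    using decseq_convergent[OF Hv_decseq, of \<mu>] ge by blast
  have step: "(\<lambda>n. x (Suc n) - x n) \<longlonglongrightarrow> 0"
    using d_tendsto_0[OF ge] by (simp add: d_def[abs_def] tendsto_norm_zero_iff)
  \<comment> \<open>Shifted back so that the prox step with index \<open>\<rho> j\<close> produces
    the point \<open>x (Suc (r (Suc j)))\<close> of the subsequence; \<open>strict_mono r\<close>
    makes \<open>r (Suc j)\<close> positive.\<close>
  define \<rho> where "\<rho> j = r (Suc j) - 1" for j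
  have \<rho>: "r (Suc j) = Suc (\<rho> j)" for j
    using seq_suble[OF r, of "Suc j"] by (simp add: \<rho>_def)
  have \<rho>_mono: "strict_mono \<rho>"
    using strict_monoD[OF r] \<rho> by (auto simp: strict_mono_Suc_iff) (metis Suc_less_eq lessI)
  have step\<rho>: "(\<lambda>j. x (Suc (\<rho> j)) - x (\<rho> j)) \<longlonglongrightarrow> 0"
    using LIMSEQ_subseq_LIMSEQ[OF step \<rho>_mono] by (simp add: o_def)
  have lp: "(\<lambda>j. x (Suc (Suc (\<rho> j)))) \<longlonglongrightarrow> p"
    using LIMSEQ_Suc[OF lim(1)] by (simp add: \<rho>)
  have lq: "(\<lambda>j. x (Suc (\<rho> j))) \<longlonglongrightarrow> q"
    using LIMSEQ_Suc[OF lim(2)] by (simp add: \<rho>)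
  have lq': "(\<lambda>j. x (\<rho> j)) \<longlonglongrightarrow> q"
    using tendsto_diff[OF lq step\<rho>] by simp
  have "(\<lambda>j. x (Suc (r j)) - x (r j)) \<longlonglongrightarrow> 0"
    using LIMSEQ_subseq_LIMSEQ[OF step r] by (simp add: o_def)
  then have pq: "q = p"
    using tendsto_diff[OF lim] LIMSEQ_unique by fastforce
  have g_cont: "isCont g p"
    using grad[of p] unfolding gderiv_def by (rule has_derivative_continuous)
  have G_cont: "isCont G p"
    using lipschitz_on_continuous_on[OF lip] by (simp add: continuous_on_eq_continuous_at)
  obtain Fp where fp: "f p = ereal Fp"
    using \<mu> by (cases "f p") (auto simp: FRB_merit_def)
  have \<mu>_eq: "\<mu> = Fp + g p"
    using \<mu> by (simp add: FRB_merit_def fp pq)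
  define B where "B j = Fp + P (\<rho> j) p - P (\<rho> j) (x (Suc (Suc (\<rho> j)))) + g (x (Suc (Suc (\<rho> j))))
    + 1 / (4 * lam) * (norm (x (Suc (Suc (\<rho> j))) - x (Suc (\<rho> j))))\<^sup>2" for j
  have "Hv (Suc (\<rho> j)) \<le> B j" for j
    using prox_step[of "\<rho> j" p] by (simp add: f_x fp B_def Hv_def)
  moreover have "B \<longlonglongrightarrow> Fp + (1 / (2 * lam) * (norm (p - p))\<^sup>2 - (G p - 2 *\<^sub>R G p) \<bullet> (p - p))
      - (1 / (2 * lam) * (norm (p - p))\<^sup>2 - (G p - 2 *\<^sub>R G p) \<bullet> (p - p)) + g p
      + 1 / (4 * lam) * (norm (p - p))\<^sup>2"
    unfolding B_def P_def e_def using lp lq lq' unfolding pq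
    by (intro tendsto_intros isCont_tendsto_compose[OF g_cont] isCont_tendsto_compose[OF G_cont])
  moreover have "(\<lambda>j. Hv (Suc (\<rho> j))) \<longlonglongrightarrow> l"
    using LIMSEQ_subseq_LIMSEQ[OF l \<rho>_mono] by (simp add: o_def)
  ultimately have "l \<le> Fp + g p"
    by (intro LIMSEQ_le[of "\<lambda>j. Hv (Suc (\<rho> j))" l B]) auto
  moreover have "\<mu> \<le> l"
    using l ge by (intro LIMSEQ_le_const) auto
  ultimately show ?thesis
    using l by (simp add: \<mu>_eq)
qed

text \<open>Used twice: with the concave \<phi> near the limit points to obtain convergence, then
  with the power function of the KL exponent to obtain the distance bound.\<close>

lemma KL_length:
  assumes KL: "KL_ineq (FRB_merit lam f g) \<mu> U \<eta> \<phi>"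
    and U: "\<forall>\<^sub>F n in sequentially. (x (Suc n), x n) \<in> U" and \<eta>: "0 < \<eta>"
    and ge: "\<And>n. \<mu> \<le> Hv (Suc n)" and lim: "(\<lambda>n. Hv (Suc n)) \<longlonglongrightarrow> \<mu>"
    and tangent: "\<And>t s. 0 < t \<Longrightarrow> ereal t < \<eta> \<Longrightarrow> 0 \<le> s \<Longrightarrow> s \<le> t \<Longrightarrow>
      left_deriv \<phi> t * (t - s) \<le> \<phi> t - \<phi> s"
    and nonneg: "\<And>t. t \<in> Ico0 \<eta> \<Longrightarrow> 0 \<le> \<phi> t"
  obtains N where "\<And>n. N \<le> n \<Longrightarrow> (x (Suc (Suc n)), x (Suc n)) \<in> U"
    and "\<And>n. N \<le> n \<Longrightarrow> ereal (Hv (Suc n) - \<mu>) < \<eta>"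
    and "convergent x"
    and "\<And>xs n. x \<longlonglongrightarrow> xs \<Longrightarrow> N \<le> n \<Longrightarrow>
      norm (x (Suc n) - xs) \<le> 2 * (M2 / M1) * \<phi> (Hv (Suc n) - \<mu>) + d n / 2"
proof -
  have "(\<lambda>n. ereal (Hv (Suc n) - \<mu>)) \<longlonglongrightarrow> ereal (\<mu> - \<mu>)"
    by (intro tendsto_intros lim)
  then have "\<forall>\<^sub>F n in sequentially. ereal (Hv (Suc n) - \<mu>) < \<eta>"
    by (rule order_tendstoD) (use \<eta> in \<open>simp flip: zero_ereal_def\<close>)
  moreover have "\<forall>\<^sub>F n in sequentially. (x (Suc (Suc n)), x (Suc n)) \<in> U"
    using U by (rule eventually_sequentially_Suc[THEN iffD2])
  ultimately have "\<forall>\<^sub>F n in sequentially.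
      ereal (Hv (Suc n) - \<mu>) < \<eta> \<and> (x (Suc (Suc n)), x (Suc n)) \<in> U"
    by (rule eventually_conj)
  then obtain N where N: "\<And>n. N \<le> n \<Longrightarrow> ereal (Hv (Suc n) - \<mu>) < \<eta>"
      "\<And>n. N \<le> n \<Longrightarrow> (x (Suc (Suc n)), x (Suc n)) \<in> U"
    unfolding eventually_sequentially by blast
  note step = KL_length_step[OF KL N(2) ge N(1) tangent]
  have pos: "0 \<le> \<phi> (Hv (Suc n) - \<mu>)" if "N \<le> n" for n
    using N(1)[OF that] ge[of n] by (intro nonneg) (simp add: Ico0_def)
  have C: "0 \<le> M2 / M1"
    using M1_pos M2_pos by simp
  note fl = finite_length_convergent[of N x "M2 / M1" "\<lambda>n. \<phi> (Hv (Suc n) - \<mu>)",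
      folded d_def, OF step(1) step(2) pos C]
  show ?thesis
    by (rule that[OF N(2) N(1) fl])
qed

section \<open>Convergence and rates of the iterates\<close>

lemma convergence_rates:
  assumes bdd: "bounded (range (\<lambda>n. (x (Suc n), x n)))"
    and V: "\<And>r p. strict_mono r \<Longrightarrow> (\<lambda>j. (x (Suc (r j)), x (r j))) \<longlonglongrightarrow> p \<Longrightarrow> p \<in> V"
    and KL: "gen_concave_KL_on (FRB_merit lam f g) V"
  shows "\<exists>xs. x \<longlonglongrightarrow> xs \<and>
    (\<forall>\<theta>\<in>{0..<1}. has_KL_exponent (FRB_merit lam f g) (xs, xs) \<theta> \<longrightarrow>
      (\<theta> = 0 \<longrightarrow> (\<forall>\<^sub>F k in sequentially. x k = xs)) \<and>
      (\<theta> \<in> {0<..1/2} \<longrightarrow>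
        (\<exists>Q1\<in>{0<..<1}. \<exists>c1>0. \<forall>\<^sub>F k in sequentially. norm (x k - xs) \<le> Q1 ^ k * c1)) \<and>
      (\<theta> \<in> {1/2<..<1} \<longrightarrow>
        (\<exists>Q2>0. \<forall>\<^sub>F k in sequentially.
          norm (x k - xs) \<le> Q2 * real k powr (- ((1 - \<theta>) / (2 * \<theta> - 1))))))"
proof -
  let ?H = "FRB_merit lam f g"
  obtain \<mu> U \<eta> \<phi> where \<mu>: "\<And>v. v \<in> V \<Longrightarrow> ?H v = ereal \<mu>" and U: "open U" "V \<subseteq> U" and \<eta>: "0 < \<eta>"
    and \<phi>: "\<phi> \<in> Phi_class \<eta>" "concave_on (Ico0 \<eta>) \<phi>" and ineq: "KL_ineq ?H \<mu> U \<eta> \<phi>"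
    using KL unfolding gen_concave_KL_on_def by blast
  obtain p q r where r: "strict_mono r" "((\<lambda>n. (x (Suc n), x n)) \<circ> r) \<longlonglongrightarrow> (p, q)"
    using bounded_imp_convergent_subsequence[OF bdd] by (metis surj_pair)
  then have lim: "(\<lambda>j. (x (Suc (r j)), x (r j))) \<longlonglongrightarrow> (p, q)"
    by (simp add: o_def)
  have Hpq: "?H (p, q) = ereal \<mu>"
    using \<mu> V[OF r(1) lim] by blast
  note lims = tendsto_fst[OF lim, simplified] tendsto_snd[OF lim, simplified]
  have ge: "\<mu> \<le> Hv (Suc n)" for n
    by (rule Hv_ge_limit_point[OF r(1) lims Hpq])
  have Hlim: "(\<lambda>n. Hv (Suc n)) \<longlonglongrightarrow> \<mu>"
    by (rule Hv_tendsto[OF r(1) lims Hpq])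
  have d0: "d \<longlonglongrightarrow> 0"
    by (rule d_tendsto_0[OF ge])
  have evU: "\<forall>\<^sub>F n in sequentially. (x (Suc n), x n) \<in> U"
    by (rule bounded_eventually_in_open[OF bdd U(1)]) (use V U(2) in blast)
  have mono: "mono_on (Ico0 \<eta>) \<phi>"
    using \<phi>(1) by (auto simp: Phi_class_def intro: strict_mono_on_imp_mono_on)
  \<comment> \<open>Convergence comes first because the exponent inequality is available only near
    \<open>(xs, xs)\<close>.\<close>
  have "convergent x"
    by (rule KL_length[OF ineq evU \<eta> ge Hlim left_deriv_concave_tangent[OF \<phi>(2) mono]])
      (use \<phi>(1) in \<open>auto simp: Phi_class_def\<close>)
  then obtain xs where xs: "x \<longlonglongrightarrow> xs"
    by (auto simp: convergent_def)
  have Zlim: "(\<lambda>n. (x (Suc n), x n)) \<longlonglongrightarrow> (xs, xs)"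
    by (intro tendsto_intros LIMSEQ_Suc xs)
  \<comment> \<open>The whole sequence counts as a subsequence, so \<open>(xs, xs)\<close> lies in
    \<open>V\<close> and the exponent inequality refers to the same level \<mu>.\<close>
  have Hxs: "?H (xs, xs) = ereal \<mu>"
    using \<mu> V[of id] Zlim by (simp add: strict_mono_id)
  show ?thesis
  proof (rule exI, rule conjI[OF xs], rule ballI, rule impI)
    fix \<theta> :: real assume \<theta>: "\<theta> \<in> {0..<1}" and "has_KL_exponent ?H (xs, xs) \<theta>"
    then obtain c \<eta>' U' where c: "0 < c" and \<eta>': "0 < \<eta>'" and U': "open U'" "(xs, xs) \<in> U'"
      and ineq': "KL_ineq ?H \<mu> U' \<eta>' (\<lambda>t. c * t powr (1 - \<theta>))"
      unfolding has_KL_exponent_def by (auto simp: Hxs)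
    have evU': "\<forall>\<^sub>F n in sequentially. (x (Suc n), x n) \<in> U'"
      using Zlim U' by (rule topological_tendstoD)
    obtain N where NU: "\<And>n. N \<le> n \<Longrightarrow> (x (Suc (Suc n)), x (Suc n)) \<in> U'"
      and N\<eta>: "\<And>n. N \<le> n \<Longrightarrow> ereal (Hv (Suc n) - \<mu>) < \<eta>'"
      and "convergent x"
      and len: "\<And>xs n. x \<longlonglongrightarrow> xs \<Longrightarrow> N \<le> n \<Longrightarrow>
        norm (x (Suc n) - xs) \<le> 2 * (M2 / M1) * (c * (Hv (Suc n) - \<mu>) powr (1 - \<theta>)) + d n / 2"
      by (rule KL_length[OF ineq' evU' \<eta>' ge Hlim left_deriv_powr_tangent])
        (use c \<theta> in auto)
    define b where "b = c * (1 - \<theta>) * M2"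
    have b: "0 < b"
      using c \<theta> M2_pos by (simp add: b_def)
    define A where "A = 2 * (M2 / M1) * c"
    have A: "0 \<le> A"
      using c M1_pos M2_pos by (simp add: A_def)
    \<comment> \<open>When the gap is zero the KL inequality says nothing, but the left side is then
      0, even for \<theta> = 0.\<close>
    have KLb: "(Hv (Suc n) - \<mu>) powr \<theta> \<le> b * (d n + d (Suc n))" if n: "N \<le> n" for n
    proof (cases "Hv (Suc n) = \<mu>")
      case True
      then show ?thesis
        using b d_nonneg by simp
    next
      case False
      with ge[of n] have pos: "0 < Hv (Suc n) - \<mu>"
        by simp
      have "1 \<le> c * (1 - \<theta>) * (Hv (Suc n) - \<mu>) powr (- \<theta>) * (M2 * (d n + d (Suc n)))"
        using KL_ineq_subgradient(1)[OF ineq' NU[OF n] pos N\<eta>[OF n]] by (simp only: left_deriv_powr[OF pos])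
      also have "\<dots> = b * (d n + d (Suc n)) / (Hv (Suc n) - \<mu>) powr \<theta>"
        by (simp add: b_def powr_minus divide_inverse mult_ac)
      finally show ?thesis
        using pos by (simp add: le_divide_eq)
    qed
    have len': "norm (x (Suc n) - xs) \<le> A * (Hv (Suc n) - \<mu>) powr (1 - \<theta>) + d n / 2" if "N \<le> n" for n
      using len[OF xs that] by (simp add: A_def mult_ac)
    \<comment> \<open>\<open>Hv 0\<close> may be junk, so the bounds are claimed from
      \<open>Suc N\<close> on, where every index is a successor.\<close>
    define h where "h n = Hv n - \<mu>" for n
    have h0: "h \<longlonglongrightarrow> 0"
      unfolding h_def by (rule LIMSEQ_imp_Suc) (use tendsto_diff[OF Hlim tendsto_const[of \<mu>]] in simp)
    have h_ge: "0 \<le> h n" if "Suc N \<le> n" for n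
      using that ge[of "n - 1"] by (cases n) (auto simp: h_def)
    have desc: "M1 * ((d n)\<^sup>2 + (d (Suc n))\<^sup>2) \<le> h n - h (Suc n)" if "Suc N \<le> n" for n
      using that descent[of "n - 1"] by (cases n) (auto simp: h_def)
    note rates = KL_rates[of "Suc N" h d M1 \<theta> b "\<lambda>n. norm (x n - xs)" A, OF h_ge d_nonneg desc _ _ h0 d0 _ _ M1_pos b A]
    have "\<theta> = 0 \<Longrightarrow> \<forall>\<^sub>F k in sequentially. norm (x k - xs) \<le> 0"
      by (rule rates(1)) (use KLb len' \<theta> in \<open>auto simp: h_def\<close>)
    moreover have "0 < \<theta> \<Longrightarrow> \<theta> \<le> 1/2 \<Longrightarrow>
        \<exists>Q\<in>{0<..<1}. \<exists>c>0. \<forall>\<^sub>F k in sequentially. norm (x k - xs) \<le> Q ^ k * c"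
      by (rule rates(2)) (use KLb len' \<theta> in \<open>auto simp: h_def\<close>)
    moreover have "1/2 < \<theta> \<Longrightarrow>
        \<exists>Q>0. \<forall>\<^sub>F k in sequentially. norm (x k - xs) \<le> Q * real k powr (- ((1 - \<theta>) / (2 * \<theta> - 1)))"
      by (rule rates(3)) (use KLb len' \<theta> in \<open>auto simp: h_def\<close>)
    ultimately show "(\<theta> = 0 \<longrightarrow> (\<forall>\<^sub>F k in sequentially. x k = xs)) \<and>
      (\<theta> \<in> {0<..1/2} \<longrightarrow>
        (\<exists>Q1\<in>{0<..<1}. \<exists>c1>0. \<forall>\<^sub>F k in sequentially. norm (x k - xs) \<le> Q1 ^ k * c1)) \<and>
      (\<theta> \<in> {1/2<..<1} \<longrightarrow>
        (\<exists>Q2>0. \<forall>\<^sub>F k in sequentially.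
          norm (x k - xs) \<le> Q2 * real k powr (- ((1 - \<theta>) / (2 * \<theta> - 1)))))"
      by simp
  qed
qed

end

section \<open>Transfer to integer indices\<close>

theorem theorem3p12:
  fixes f :: "real ^ 'n \<Rightarrow> ereal"
    and g :: "real ^ 'n \<Rightarrow> real"
    and grad_g :: "real ^ 'n \<Rightarrow> real ^ 'n"
    and L lam :: real
    and x :: "int \<Rightarrow> real ^ 'n"
    and z :: "int \<Rightarrow> (real ^ 'n) \<times> (real ^ 'n)"
    and H :: "(real ^ 'n) \<times> (real ^ 'n) \<Rightarrow> ereal"
  assumes "proper_fun f" and "lsc f" and "prox_bounded f" and "0 < prox_threshold f"
    and "\<And>u. GDERIV g u :> grad_g u"
    and "0 < L" and "L-lipschitz_on UNIV grad_g"
    and "(INF u. f u + ereal (g u)) > -\<infinity>"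
    and "0 < lam" and "ereal lam < min (ereal (1 / (4 * L))) (prox_threshold f)"
    and "FRB_sequence lam f grad_g x"
    and z_def: "\<And>k. z k = (x (k + 1), x k)"
    and "bounded (z ` {-1..})"
    and H_def: "H = FRB_merit lam f g"
    and "gen_concave_KL_on H (seq_limit_points z)"
  shows "\<exists>xs. (\<lambda>k. x (int k)) \<longlonglongrightarrow> xs \<and>
    (\<forall>\<theta>\<in>{0..<1}. has_KL_exponent H (xs, xs) \<theta> \<longrightarrow>
      (\<theta> = 0 \<longrightarrow> (\<forall>\<^sub>F k in sequentially. x (int k) = xs)) \<and>
      (\<theta> \<in> {0<..1/2} \<longrightarrow>
        (\<exists>Q1\<in>{0<..<1}. \<exists>c1>0. \<forall>\<^sub>F k in sequentially.
          norm (x (int k) - xs) \<le> Q1 ^ k * c1)) \<and>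
      (\<theta> \<in> {1/2<..<1} \<longrightarrow>
        (\<exists>Q2>0. \<forall>\<^sub>F k in sequentially.
          norm (x (int k) - xs) \<le> Q2 * real k powr (- ((1 - \<theta>) / (2 * \<theta> - 1))))))"
proof -
  interpret FRB_iteration f g grad_g L lam "\<lambda>n. x (int n)"
  proof
    show "lam < 1 / (4 * L)"
      using assms(10) by simp
    \<comment> \<open>This is the FRB step with \<open>k = n + 1\<close>.\<close>
    show "x (int (Suc (Suc n))) \<in> Prox lam f
        (x (int (Suc n)) + lam *\<^sub>R (grad_g (x (int n)) - grad_g (x (int (Suc n)))) - lam *\<^sub>R grad_g (x (int (Suc n))))" for n
      using assms(11)[unfolded FRB_sequence_def Let_def, rule_format, of "1 + int n"] by (simp add: add.commute)
  qed (fact assms)+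
  have z_nat: "z (int n) = (x (int (Suc n)), x (int n))" for n
    by (simp add: z_def add.commute)
  have bdd: "bounded (range (\<lambda>n. (x (int (Suc n)), x (int n))))"
    unfolding z_nat[symmetric] by (rule bounded_subset[OF assms(13)]) auto
  have lim: "p \<in> seq_limit_points z"
    if "strict_mono r" "(\<lambda>j. (x (int (Suc (r j))), x (int (r j)))) \<longlonglongrightarrow> p" for r p
    unfolding seq_limit_points_def
  proof (intro CollectI exI[of _ "\<lambda>j. int (r j)"] conjI)
    show "strict_mono (\<lambda>j. int (r j))"
      using that(1) by (simp add: strict_mono_def)
    show "(\<lambda>j. z (int (r j))) \<longlonglongrightarrow> p"
      unfolding z_nat by (rule that(2))
  qed simp
  show ?thesis
    unfolding H_def by (rule convergence_rates[OF bdd lim assms(15)[unfolded H_def]])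
qed

end
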